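(* Let $N\ge2$, let $(p_i)_{i\ge1}$ be positive, $q_1,\dots,q_N>1$, and $0\le r<t$ integers. Let $\bm y,\bm y'\in\mathsf{W}_N$ with $\bm y\subseteq\bm y'$. Let $\mathcal{Q}_{(r,t]}(\bm y,\bm y')$ be the dTASEP probability that particles starting from locations $(y_1-1>y_2-2>\dots>y_N-N)$ at time $r$ end up at locations $(y_1'-1>\dots>y_N'-N)$ at time $t$. Then $$\mathcal{Q}_{(r,t]}(\bm y,\bm y')=\frac{\prod_{i=1}^Nq_i^{y_i'-y_i}}{Z_{(r,t]}}\sum_{\substack{\lambda,\mu\in\mathsf{W}_N:\\ \mu\subseteq\lambda,\,\mu\subseteq\bm y,\,\bm y'\subseteq\lambda}}\mathrm{wt}\bigg(\mathsf{h}\Pi^{\{(\lambda_i-i,N)\}_i}_{\{(y_i'-i,i)\}_i,\uparrow}\ \sqcup\ (\mathsf{e}\Pi^* )^{\{(\mu_i-i,N+t-r)\}_i}_{\{(\lambda_i-i,N)\}_i}\ \sqcup\ \mathsf{e}\Pi^{\{(y_i-i,2N+t-r-i)\}_i}_{\{(\mu_i-i,N+t-r)\}_i}\bigg),$$ where in all sets $i$ ranges over $1\le i\le N$, with edge weights as follows: - all vertical edges have weight $1$; - horizontal edges between $(x,i)$ and $(x+1,i)$, $x\in\mathbb{Z}$, $1\le i\le N$, have weight $q_i$; - diagonal up-left edges between $(x,i)$ and $(x-1,i+1)$, $x\in\mathbb{Z}$, $N\le i\le N+t-r-1$, have weight $p_{N+t-i}$; - diagonal up-right edges between $(x,i)$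 and $(x+1,i+1)$, $x\in\mathbb{Z}$, $N+t-r\le i\le 2N+t-r-2$, have weight $-q_{2N+t-r-i}$. Moreover, choose $x_0\in\mathbb{Z}$ with $x_0-1<y_N-N$, and set $x^{(0)}_i=x_0-i$ for $1\le i\le N$. Then, with the same weights and with $\widehat Z_{(r,t]}:=Z_{(r,t]}\prod_{i=1}^Nq_i^{y_i-x_0}$, $$\mathcal{Q}_{(r,t]}(\bm y,\bm y')=\frac{1}{\widehat Z_{(r,t]}}\sum_{\substack{\lambda,\mu\in\mathsf{W}_N:\\ \mu\subseteq\lambda,\,\mu\subseteq\bm y,\,\bm y'\subseteq\lambda}}\mathrm{wt}\bigg(\mathsf{h}\Pi^{\{(y_i'-i,i)\}_i}_{\{(x_i^{(0)},i)\}_i}\ \sqcup\ \mathsf{h}\Pi^{\{(\lambda_i-i,N)\}_i}_{\{(y_i'-i,i)\}_i,\uparrow}\ \sqcup\ (\mathsf{e}\Pi^* )^{\{(\mu_i-i,N+t-r)\}_i}_{\{(\lambda_i-i,N)\}_i}\ \sqcup\ \mathsf{e}\Pi^{\{(y_i-i,2N+t-r-i)\}_i}_{\{(\mu_i-i,N+t-r)\}_i}\bigg).$$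
   Context: $\mathsf{W}_N=\{\bm y\in\mathbb{Z}^N:y_1\ge\dots\ge y_N\}$; $\mu\subseteq\lambda$ means $\mu_i\le\lambda_i$ for all $i$. $Z_{(r,t]}=\prod_{i=r+1}^t\prod_{j=1}^N(1+p_iq_j)$. dTASEP: particle positions $Y_1(s)>\dots>Y_N(s)$ in $\mathbb{Z}$ evolve by $Y_k(s)=\min\{Y_{k-1}(s)-1,\,Y_k(s-1)+W_{s,k}\}$, updated sequentially for $k=1,\dots,N$ (with $Y_0\equiv\infty$), where the $W_{s,k}$ are independent Bernoulli with $\mathbb{P}(W_{s,k}=1)=p_sq_k/(1+p_sq_k)$. Path ensembles, given starting points $(y_k,i_k)$ (subscript) and endpoints $(x_k,j_k)$ (superscript), $1\le k\le N$: each is the set of $N$-tuples $(\pi_1,\dots,\pi_N)$ of (vertex-)non-intersecting paths in $\mathbb{Z}^2$ with $\pi_k$ from $(y_k,i_k)$ to $(x_k,j_k)$, where the allowed steps are: for $\mathsf{h}\Pi$, $(x,j)\to(x,j+1)$ or $(x+1,j)$; for $\mathsf{h}\Pi_{\cdot,\uparrow}$, same as $\mathsf{h}\Pi$ but the first step of each path is vertical (a path starting and ending at level $N$ must be trivial, with no steps); for $\mathsf{e}\Pi$, $(x,j)\to(x,j+1)$ or $(x+1,j+1)$; for $\mathsf{e}\Pi^*$, $(x,j)\to(x,j+1)$ or $(x-1,j+1)$. Concatenation: if the endpoints of the $j$-th paths of $\Sigma^{(1)}$ are the starting points of the $j$-th paths of $\Sigma^{(2)}$, then $\Sigma^{(1)}\sqcup\Sigma^{(2)}$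 is the ensemble of all tuples $(\pi^{(1)}_1\cup\pi^{(2)}_1,\dots,\pi^{(1)}_N\cup\pi^{(2)}_N)$ with $(\pi^{(a)}_j)_j\in\Sigma^{(a)}$, $a=1,2$. The weight of a path is the product of its edge weights (trivial path: $1$), of a tuple the product over its paths, and $\mathrm{wt}$ of an ensemble is the sum over its tuples. *)

theory Defs
  imports "HOL-Probability.Probability" "HOL-Library.FuncSet" "HOL-Library.Disjoint_Sets"
begin

(* N-tuples are extensional functions on {1..N} (value undefined elsewhere), so that each
   tuple is represented exactly once and sums over sets of tuples have the right
   multiplicities. *)

definition Weyl :: "nat \<Rightarrow> (nat \<Rightarrow> int) set" where
  "Weyl N = {y \<in> {1..N} \<rightarrow>\<^sub>E UNIV. \<forall>i\<in>{1..N}. \<forall>j\<in>{1..N}. i \<le> j \<longrightarrow> y j \<le> y i}"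

definition contained :: "nat \<Rightarrow> (nat \<Rightarrow> int) \<Rightarrow> (nat \<Rightarrow> int) \<Rightarrow> bool" where
  "contained N mu lam \<longleftrightarrow> (\<forall>i\<in>{1..N}. mu i \<le> lam i)"

definition Zconst :: "nat \<Rightarrow> (nat \<Rightarrow> real) \<Rightarrow> (nat \<Rightarrow> real) \<Rightarrow> nat \<Rightarrow> nat \<Rightarrow> real" where
  "Zconst N p q r t = (\<Prod>i = Suc r..t. \<Prod>j = 1..N. 1 + p i * q j)"


subsection \<open>The discrete-time TASEP\<close>

(* One sequential update of the positions Y, where W k says whether particle k tries to jump.
   Particle 1 is unconstrained since Y_0 is infinity; the value at index 0 is a dummy. *)
fun dtasep_step :: "(nat \<Rightarrow> bool) \<Rightarrow> (nat \<Rightarrow> int) \<Rightarrow> nat \<Rightarrow> int" where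
  "dtasep_step W Y 0 = Y 0"
| "dtasep_step W Y (Suc 0) = Y (Suc 0) + of_bool (W (Suc 0))"
| "dtasep_step W Y (Suc (Suc k)) =
     min (dtasep_step W Y (Suc k) - 1) (Y (Suc (Suc k)) + of_bool (W (Suc (Suc k))))"

(* dtasep W r a m k is the position of particle k at time r + m, started from a at time r. *)
primrec dtasep :: "(nat \<times> nat \<Rightarrow> bool) \<Rightarrow> nat \<Rightarrow> (nat \<Rightarrow> int) \<Rightarrow> nat \<Rightarrow> nat \<Rightarrow> int" where
  "dtasep W r a 0 = a"
| "dtasep W r a (Suc m) = dtasep_step (\<lambda>k. W (r + Suc m, k)) (dtasep W r a m)"

(* Joint law of the independent Bernoulli variables W_{s,k}, r < s <= t, 1 <= k <= N. *)
definition jump_pmf ::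
    "nat \<Rightarrow> (nat \<Rightarrow> real) \<Rightarrow> (nat \<Rightarrow> real) \<Rightarrow> nat \<Rightarrow> nat \<Rightarrow> (nat \<times> nat \<Rightarrow> bool) pmf" where
  "jump_pmf N p q r t =
     Pi_pmf ({r<..t} \<times> {1..N}) False (\<lambda>(s, k). bernoulli_pmf (p s * q k / (1 + p s * q k)))"

definition dtasep_prob ::
    "nat \<Rightarrow> (nat \<Rightarrow> real) \<Rightarrow> (nat \<Rightarrow> real) \<Rightarrow> nat \<Rightarrow> nat \<Rightarrow> (nat \<Rightarrow> int) \<Rightarrow> (nat \<Rightarrow> int) \<Rightarrow> real" where
  "dtasep_prob N p q r t y y' =
     measure_pmf.prob (jump_pmf N p q r t)
       {W. \<forall>k\<in>{1..N}. dtasep W r (\<lambda>i. y i - int i) (t - r) k = y' k - int k}"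


subsection \<open>Path ensembles\<close>

type_synonym vertex = "int \<times> int"

fun h_step :: "vertex \<Rightarrow> vertex \<Rightarrow> bool" where
  "h_step (x, j) v \<longleftrightarrow> v = (x, j + 1) \<or> v = (x + 1, j)"

fun e_step :: "vertex \<Rightarrow> vertex \<Rightarrow> bool" where
  "e_step (x, j) v \<longleftrightarrow> v = (x, j + 1) \<or> v = (x + 1, j + 1)"

fun estar_step :: "vertex \<Rightarrow> vertex \<Rightarrow> bool" where
  "estar_step (x, j) v \<longleftrightarrow> v = (x, j + 1) \<or> v = (x - 1, j + 1)"

(* A path is the nonempty list of its successive vertices; a trivial path has one vertex. *)
definition is_path :: "(vertex \<Rightarrow> vertex \<Rightarrow> bool) \<Rightarrow> vertex \<Rightarrow> vertex \<Rightarrow> vertex list \<Rightarrow> bool" where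
  "is_path step a b \<pi> \<longleftrightarrow> \<pi> \<noteq> [] \<and> hd \<pi> = a \<and> last \<pi> = b \<and> successively step \<pi>"

definition path_ensemble ::
    "(vertex \<Rightarrow> vertex \<Rightarrow> bool) \<Rightarrow> nat \<Rightarrow> (nat \<Rightarrow> vertex) \<Rightarrow> (nat \<Rightarrow> vertex) \<Rightarrow> (nat \<Rightarrow> vertex list) set" where
  "path_ensemble step N A B =
     {\<pi> \<in> {1..N} \<rightarrow>\<^sub>E UNIV.
        (\<forall>k\<in>{1..N}. is_path step (A k) (B k) (\<pi> k)) \<and>
        disjoint_family_on (\<lambda>k. set (\<pi> k)) {1..N}}"

abbreviation hPi :: "nat \<Rightarrow> (nat \<Rightarrow> vertex) \<Rightarrow> (nat \<Rightarrow> vertex) \<Rightarrow> (nat \<Rightarrow> vertex list) set" where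
  "hPi \<equiv> path_ensemble h_step"

abbreviation ePi :: "nat \<Rightarrow> (nat \<Rightarrow> vertex) \<Rightarrow> (nat \<Rightarrow> vertex) \<Rightarrow> (nat \<Rightarrow> vertex list) set" where
  "ePi \<equiv> path_ensemble e_step"

abbreviation ePi_star :: "nat \<Rightarrow> (nat \<Rightarrow> vertex) \<Rightarrow> (nat \<Rightarrow> vertex) \<Rightarrow> (nat \<Rightarrow> vertex list) set" where
  "ePi_star \<equiv> path_ensemble estar_step"

definition hPi_up :: "nat \<Rightarrow> (nat \<Rightarrow> vertex) \<Rightarrow> (nat \<Rightarrow> vertex) \<Rightarrow> (nat \<Rightarrow> vertex list) set" where
  "hPi_up N A B =
     {\<pi> \<in> hPi N A B. \<forall>k\<in>{1..N}.
        (\<exists>x j \<rho>. \<pi> k = (x, j) # (x, j + 1) # \<rho>) \<or> (\<exists>x. \<pi> k = [(x, int N)])}"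

(* Meant for ensembles where the endpoints on the left are the starting points on the right;
   tl drops the shared vertex. *)
definition concat_ensembles ::
    "(nat \<Rightarrow> vertex list) set \<Rightarrow> nat \<Rightarrow> (nat \<Rightarrow> vertex list) set \<Rightarrow> (nat \<Rightarrow> vertex list) set"
    ("(_ \<squnion>\<^bsub>_\<^esub> _)" [65, 0, 66] 65) where
  "\<Sigma> \<squnion>\<^bsub>N\<^esub> \<Sigma>' = {(\<lambda>j\<in>{1..N}. \<pi> j @ tl (\<pi>' j)) | \<pi> \<pi>'. \<pi> \<in> \<Sigma> \<and> \<pi>' \<in> \<Sigma>'}"


subsection \<open>Weights\<close>

definition path_weight :: "(vertex \<Rightarrow> vertex \<Rightarrow> real) \<Rightarrow> vertex list \<Rightarrow> real" where
  "path_weight w \<pi> = prod_list (map2 w \<pi> (tl \<pi>))"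

definition wt :: "nat \<Rightarrow> (vertex \<Rightarrow> vertex \<Rightarrow> real) \<Rightarrow> (nat \<Rightarrow> vertex list) set \<Rightarrow> real" where
  "wt N w \<Sigma> = (\<Sum>\<pi>\<in>\<Sigma>. \<Prod>k = 1..N. path_weight w (\<pi> k))"

(* The final 0 concerns only pairs of vertices that are not edges of any path considered. *)
fun edge_weight ::
    "nat \<Rightarrow> (nat \<Rightarrow> real) \<Rightarrow> (nat \<Rightarrow> real) \<Rightarrow> nat \<Rightarrow> nat \<Rightarrow> vertex \<Rightarrow> vertex \<Rightarrow> real" where
  "edge_weight N p q r t (x, i) v =
     (if v = (x, i + 1) then 1
      else if v = (x + 1, i) \<and> 1 \<le> i \<and> i \<le> int N then q (nat i)
      else if v = (x - 1, i + 1) \<and> int N \<le> i \<and> i \<le> int N + int t - int r - 1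
        then p (nat (int N + int t - i))
      else if v = (x + 1, i + 1) \<and> int N + int t - int r \<le> i \<and> i \<le> 2 * int N + int t - int r - 2
        then - q (nat (2 * int N + int t - int r - i))
      else 0)"


subsection \<open>Start and end points, and the index set of the sum\<close>

definition pts :: "(nat \<Rightarrow> int) \<Rightarrow> (nat \<Rightarrow> int) \<Rightarrow> nat \<Rightarrow> vertex" where
  "pts y level i = (y i - int i, level i)"

(* Infinite, but the summands vanish outside a finite subset: the weight is nonzero only if
   y i - N <= mu i <= lam i <= mu i + (t - r). *)
definition intermediates ::
    "nat \<Rightarrow> (nat \<Rightarrow> int) \<Rightarrow> (nat \<Rightarrow> int) \<Rightarrow> ((nat \<Rightarrow> int) \<times> (nat \<Rightarrow> int)) set" where
  "intermediates N y y' =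
     {(lam, mu). lam \<in> Weyl N \<and> mu \<in> Weyl N \<and>
        contained N mu lam \<and> contained N mu y \<and> contained N y' lam}"

end

theory Submission
  imports Defs
begin

text \<open>
  Read the pieces of the path ensemble as matrices. The up-right paths from \<open>y'\<close> to \<open>lam\<close> give
  \<open>A(lam, y')\<close>, the weight of the Gelfand-Tsetlin patterns with top row \<open>lam\<close> and left edge \<open>y'\<close>: row
  \<open>k\<close> of the pattern records where the paths leave level \<open>k\<close>. The up-left paths from \<open>lam\<close> to \<open>mu\<close>
  give \<open>S(mu, lam)\<close>, a product of \<open>t - r\<close> vertical-strip matrices, one for each time, and the signed
  paths from \<open>mu\<close> to \<open>y\<close> give a matrix \<open>B(y, mu)\<close>. The endpoints of a piece determine the lengths of
  its paths, so a concatenated tuple can be cut in only one way; hence the weight of a concatenation is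
  a product (\<open>wt_concat\<close>) and the claim says that the transition probability is
  \<open>q^(y' - y) / Z * (B S A)(y, y')\<close>.

  Two facts prove this. First, \<open>B A = 1\<close> (\<open>inverse_op_gt_weight\<close>). Peeling the last row of the
  pattern against the first signed step reduces the number of particles by one, and the terms in
  which the two do not agree vanish or cancel in pairs. Second, \<open>S A = A G\<close> for a single time step
  (\<open>intertwining\<close>), where \<open>G\<close> is the one-step transition matrix of the dTASEP, conjugated by the
  diagonal matrix \<open>q^y\<close> and freed from the normalisation \<open>\<Prod>(1 + p q_k)\<close>. This is again an induction on
  the number of rows: the new position of particle \<open>n + 1\<close> depends only on its old position and on the
  new position of particle \<open>n\<close>, so that a statement on two neighbouring rows suffices. That
  statement (\<open>dual_cauchy_one_step\<close>) is the dual skew Cauchy identity for one variable, refined by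
  the value of the last part; both sides factor over the coordinates, and the factors are compared
  one coordinate at a time.

  Starting from \<open>B A = 1\<close> and moving one strip matrix after the other through \<open>A\<close> turns \<open>B S A\<close> into the
  product of the transition matrices, which by the Markov property (\<open>dtasep_prob_Suc\<close>) is the
  transition probability over \<open>t - r\<close> steps (\<open>dtasep_prob_eq_operators\<close>). In the second
  formula the additional horizontal paths only contribute the factor \<open>\<Prod>q_i^(y'_i - x0)\<close>.
\<close>

section \<open>Gelfand-Tsetlin patterns and vertical strips\<close>

lemma WeylI_adjacent:
  assumes "y \<in> {1..n} \<rightarrow>\<^sub>E UNIV" and "\<And>i. 1 \<le> i \<Longrightarrow> i < n \<Longrightarrow> y (Suc i) \<le> y i"
  shows "y \<in> Weyl n"
proof -
  have "y j \<le> y i" if "i \<le> j" "1 \<le> i" "j \<le> n" for i j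
    using that
  proof (induction j rule: dec_induct)
    case (step m)
    have "y (Suc m) \<le> y m" using assms(2)[of m] step.prems step.hyps by linarith
    then show ?case using step by linarith
  qed simp
  then show ?thesis using assms(1) by (auto simp: Weyl_def)
qed

lemma Weyl_mono: "y \<in> Weyl n \<Longrightarrow> 1 \<le> i \<Longrightarrow> i \<le> j \<Longrightarrow> j \<le> n \<Longrightarrow> y j \<le> y i"
  by (auto simp: Weyl_def)

lemma Weyl_ext: "y \<in> Weyl n \<Longrightarrow> y \<in> extensional {1..n}"
  by (auto simp: Weyl_def PiE_def)

text \<open>
  For \<open>d = 1\<close> these are the signatures that exceed \<open>x\<close> by a vertical strip, for \<open>d = -1\<close> those that \<open>x\<close>
  exceeds by a vertical strip.
\<close>

definition strip :: "nat \<Rightarrow> int \<Rightarrow> (nat \<Rightarrow> int) \<Rightarrow> (nat \<Rightarrow> int) set" where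
  "strip n d x = Weyl n \<inter> (\<Pi>\<^sub>E i\<in>{1..n}. {x i, x i + d})"

text \<open>
  The rows of length \<open>n\<close> that fit below the row \<open>lam\<close> of length \<open>n + 1\<close> in a Gelfand-Tsetlin
  pattern.
\<close>

definition interlacing :: "nat \<Rightarrow> (nat \<Rightarrow> int) \<Rightarrow> (nat \<Rightarrow> int) set" where
  "interlacing n lam = (\<Pi>\<^sub>E i\<in>{1..n}. {lam (Suc i)..lam i})"

text \<open>
  The generating function of the Gelfand-Tsetlin patterns with top row \<open>lam\<close> whose smallest entries,
  row by row, are \<open>y\<close>. The entries of the left edge are not counted in the weight: multiplying by
  \<open>\<Prod>q_i^(y_i)\<close> and summing over \<open>y\<close> would give the Schur polynomial of \<open>lam\<close>.
\<close>

fun gt_weight :: "(nat \<Rightarrow> real) \<Rightarrow> nat \<Rightarrow> (nat \<Rightarrow> int) \<Rightarrow> (nat \<Rightarrow> int) \<Rightarrow> real" where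
  "gt_weight q 0 lam y = 1"
| "gt_weight q (Suc n) lam y = (if lam (Suc n) = y (Suc n)
     then \<Sum>kap\<in>interlacing n lam. (\<Prod>i=1..n. q (Suc n) powi (lam i - kap i)) * gt_weight q n kap y
     else 0)"

text \<open>
  The time runs backwards along the paths, so the first step away from \<open>lam\<close> carries the parameter of
  the latest time \<open>r + m\<close>.
\<close>

fun strips_weight :: "(nat \<Rightarrow> real) \<Rightarrow> nat \<Rightarrow> nat \<Rightarrow> nat \<Rightarrow> (nat \<Rightarrow> int) \<Rightarrow> (nat \<Rightarrow> int) \<Rightarrow> real" where
  "strips_weight p r n 0 lam mu = of_bool (lam = mu)"
| "strips_weight p r n (Suc m) lam mu =
     (\<Sum>kap\<in>strip n (-1) lam. (\<Prod>i=1..n. p (Suc (r + m)) powi (lam i - kap i)) * strips_weight p r n m kap mu)"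

text \<open>
  The signed paths: the first step is made by the paths \<open>1, \<dots>, n\<close> only, the last path being
  trivial. As a matrix this is the inverse of \<open>gt_weight\<close>, see \<open>inverse_op_gt_weight\<close>.
\<close>

fun inverse_weight :: "(nat \<Rightarrow> real) \<Rightarrow> nat \<Rightarrow> (nat \<Rightarrow> int) \<Rightarrow> (nat \<Rightarrow> int) \<Rightarrow> real" where
  "inverse_weight q 0 y mu = 1"
| "inverse_weight q (Suc n) y mu = (if mu (Suc n) = y (Suc n)
     then \<Sum>kap\<in>strip n 1 mu. (\<Prod>i=1..n. (- q (Suc n)) powi (kap i - mu i)) * inverse_weight q n y kap
     else 0)"

lemma finite_strip [simp]: "finite (strip n d x)"
  unfolding strip_def by (intro finite_Int disjI2 finite_PiE) auto

lemma finite_interlacing [simp]: "finite (interlacing n x)"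
  unfolding interlacing_def by (intro finite_PiE) auto

lemma strip_Weyl: "z \<in> strip n d x \<Longrightarrow> z \<in> Weyl n"
  by (simp add: strip_def)

lemma strip_cases: "z \<in> strip n d x \<Longrightarrow> 1 \<le> i \<Longrightarrow> i \<le> n \<Longrightarrow> z i = x i \<or> z i = x i + d"
  by (auto simp: strip_def PiE_iff)

lemma strip_sym:
  assumes "x \<in> Weyl n" "z \<in> Weyl n"
  shows "z \<in> strip n d x \<longleftrightarrow> x \<in> strip n (-d) z"
proof -
  have "(z i \<in> {x i, x i + d}) = (x i \<in> {z i, z i + - d})" for i by auto
  then show ?thesis using assms Weyl_ext[OF assms(1)] Weyl_ext[OF assms(2)]
    unfolding strip_def PiE_iff Int_iff by metis
qed

lemma interlacing_bounds:
  "z \<in> interlacing n lam \<Longrightarrow> 1 \<le> i \<Longrightarrow> i \<le> n \<Longrightarrow> lam (Suc i) \<le> z i \<and> z i \<le> lam i"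
  by (auto simp: interlacing_def PiE_iff)

lemma interlacing_Weyl:
  assumes "z \<in> interlacing n lam" shows "z \<in> Weyl n"
proof (rule WeylI_adjacent)
  show "z \<in> {1..n} \<rightarrow>\<^sub>E UNIV" using assms by (auto simp: interlacing_def PiE_iff)
  fix i assume "1 \<le> i" "i < n"
  then show "z (Suc i) \<le> z i"
    using interlacing_bounds[OF assms, of i] interlacing_bounds[OF assms, of "Suc i"] by linarith
qed

lemma gt_weight_last:
  assumes "gt_weight q n lam y \<noteq> 0" "n \<ge> 1" shows "lam n = y n"
  using assms by (cases n) (auto split: if_splits)

text \<open>
  The supports of the three matrices. They make all sums over intermediate signatures finite and turn
  the sum over nested pairs \<open>lam\<close>, \<open>mu\<close> into an iterated sum over boxes.
\<close>

lemma gt_weight_support: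
  "gt_weight q n lam y \<noteq> 0 \<Longrightarrow> 1 \<le> i \<Longrightarrow> i \<le> n \<Longrightarrow> y i \<le> lam i"
proof (induction n arbitrary: lam)
  case (Suc n)
  have eq: "lam (Suc n) = y (Suc n)" using gt_weight_last[OF Suc.prems(1)] by simp
  with Suc.prems(1) obtain kap where k: "kap \<in> interlacing n lam" "gt_weight q n kap y \<noteq> 0"
    by (auto elim!: sum.not_neutral_contains_not_neutral)
  show ?case
  proof (cases "i = Suc n")
    case False
    then have "i \<le> n" using Suc.prems by linarith
    then show ?thesis using Suc.IH[OF k(2) Suc.prems(2)] interlacing_bounds[OF k(1) Suc.prems(2)] by linarith
  qed (simp add: eq)
qed simp

lemma strips_weight_support:
  "strips_weight p r n m lam mu \<noteq> 0 \<Longrightarrow> 1 \<le> i \<Longrightarrow> i \<le> n \<Longrightarrow> mu i \<le> lam i \<and> lam i \<le> mu i + int m"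
proof (induction m arbitrary: lam)
  case (Suc m)
  then obtain kap where k: "kap \<in> strip n (-1) lam" "strips_weight p r n m kap mu \<noteq> 0"
    by (auto elim!: sum.not_neutral_contains_not_neutral)
  then show ?case using Suc.IH[OF k(2) Suc.prems(2,3)] strip_cases[OF k(1) Suc.prems(2,3)] by auto
qed (auto split: if_splits)

lemma inverse_weight_support:
  "inverse_weight q n y mu \<noteq> 0 \<Longrightarrow> 1 \<le> i \<Longrightarrow> i \<le> n \<Longrightarrow> y i - int n \<le> mu i \<and> mu i \<le> y i"
proof (induction n arbitrary: mu)
  case (Suc n)
  then have eq: "mu (Suc n) = y (Suc n)" by (auto split: if_splits)
  with Suc.prems(1) obtain kap where k: "kap \<in> strip n 1 mu" "inverse_weight q n y kap \<noteq> 0"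
    by (auto elim!: sum.not_neutral_contains_not_neutral)
  show ?case
  proof (cases "i = Suc n")
    case False
    then have "i \<le> n" using Suc.prems by linarith
    then show ?thesis using Suc.IH[OF k(2) Suc.prems(2)] strip_cases[OF k(1) Suc.prems(2)] by auto
  qed (simp add: eq)
qed simp

text \<open>
  Exchange of two summations whose inner ranges depend on the outer variable; the two descriptions of
  the range have to agree only where the summand does not vanish.
\<close>

lemma sum_swap_dependent:
  fixes g :: "'a \<Rightarrow> 'b \<Rightarrow> 'c :: comm_monoid_add"
  assumes "finite X" "finite Y" "\<And>x. x \<in> X \<Longrightarrow> finite (D x)" "\<And>z. z \<in> Y \<Longrightarrow> finite (U z)"
    and "\<And>x z. x \<in> X \<Longrightarrow> z \<in> D x \<Longrightarrow> g x z \<noteq> 0 \<Longrightarrow> z \<in> Y \<and> x \<in> U z"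
    and "\<And>x z. z \<in> Y \<Longrightarrow> x \<in> U z \<Longrightarrow> g x z \<noteq> 0 \<Longrightarrow> x \<in> X \<and> z \<in> D x"
  shows "(\<Sum>x\<in>X. \<Sum>z\<in>D x. g x z) = (\<Sum>z\<in>Y. \<Sum>x\<in>U z. g x z)"
proof -
  have eq: "x \<in> X \<and> z \<in> D x \<and> g x z \<noteq> 0 \<longleftrightarrow> z \<in> Y \<and> x \<in> U z \<and> g x z \<noteq> 0" for x z
    using assms(5,6) by blast
  have "(\<Sum>x\<in>X. \<Sum>z\<in>D x. g x z) = (\<Sum>(x, z)\<in>Sigma X D. g x z)"
    using assms(1,3) by (intro sum.Sigma) auto
  also have "\<dots> = (\<Sum>(x, z)\<in>{(x, z). x \<in> X \<and> z \<in> D x \<and> g x z \<noteq> 0}. g x z)"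
    using assms(1,3) by (intro sum.mono_neutral_right) auto
  also have "\<dots> = (\<Sum>(x, z)\<in>{(x, z). z \<in> Y \<and> x \<in> U z \<and> g x z \<noteq> 0}. g x z)"
    unfolding eq ..
  also have "\<dots> = (\<Sum>(z, x)\<in>{(z, x). z \<in> Y \<and> x \<in> U z \<and> g x z \<noteq> 0}. g x z)"
    by (rule sum.reindex_bij_witness[of _ prod.swap prod.swap]) auto
  also have "\<dots> = (\<Sum>(z, x)\<in>Sigma Y U. g x z)"
    using assms(2,4) by (intro sum.mono_neutral_left) auto
  also have "\<dots> = (\<Sum>z\<in>Y. \<Sum>x\<in>U z. g x z)"
    using assms(2,4) by (intro sum.Sigma[symmetric]) auto
  finally show ?thesis .
qed

section \<open>The matrices as operators\<close>

text \<open>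
  The matrices act on functions of a signature. In this form every sum ranges over the finitely many
  neighbours of a given signature, and products of the infinite matrices need no further care.
\<close>

definition strip_op :: "nat \<Rightarrow> real \<Rightarrow> ((nat \<Rightarrow> int) \<Rightarrow> real) \<Rightarrow> (nat \<Rightarrow> int) \<Rightarrow> real" where
  "strip_op n c f nu = (\<Sum>lam\<in>strip n 1 nu. (\<Prod>i=1..n. c powi (lam i - nu i)) * f lam)"

text \<open>
  The recursion splits off the step at the latest time on the side of the function \<open>f\<close>. This is the
  order in which the strip matrices are moved through the patterns in
  \<open>dtasep_prob_eq_operators\<close>.
\<close>

fun strips_op :: "(nat \<Rightarrow> real) \<Rightarrow> nat \<Rightarrow> nat \<Rightarrow> nat \<Rightarrow> ((nat \<Rightarrow> int) \<Rightarrow> real) \<Rightarrow> (nat \<Rightarrow> int) \<Rightarrow> real" where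
  "strips_op p r n 0 f = f"
| "strips_op p r n (Suc m) f = strips_op p r n m (strip_op n (p (Suc (r + m))) f)"

definition lifts :: "nat \<Rightarrow> nat \<Rightarrow> (nat \<Rightarrow> int) \<Rightarrow> (nat \<Rightarrow> int) set" where
  "lifts n m mu = Weyl n \<inter> (\<Pi>\<^sub>E i\<in>{1..n}. {mu i..mu i + int m})"

definition drops :: "nat \<Rightarrow> (nat \<Rightarrow> int) \<Rightarrow> (nat \<Rightarrow> int) set" where
  "drops n y = Weyl n \<inter> (\<Pi>\<^sub>E i\<in>{1..n}. {y i - int n..y i})"

lemma finite_lifts [simp]: "finite (lifts n m x)"
  unfolding lifts_def by (intro finite_Int disjI2 finite_PiE) auto

lemma finite_drops [simp]: "finite (drops n x)"
  unfolding drops_def by (intro finite_Int disjI2 finite_PiE) auto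

lemma strips_weight_lifts:
  "strips_weight p r n m lam mu \<noteq> 0 \<Longrightarrow> lam \<in> Weyl n \<Longrightarrow> lam \<in> lifts n m mu"
  using strips_weight_support[of p r n m lam mu] Weyl_ext[of lam n]
  by (auto simp: lifts_def PiE_iff)

lemma inverse_weight_drops:
  "inverse_weight q n y mu \<noteq> 0 \<Longrightarrow> mu \<in> Weyl n \<Longrightarrow> mu \<in> drops n y"
  using inverse_weight_support[of q n y mu] Weyl_ext[of mu n]
  by (auto simp: drops_def PiE_iff)

text \<open>
  The weight of the strips peels off the step next to \<open>lam\<close> with \<open>lam\<close> fixed, the operator sums over
  \<open>lam\<close> with the intermediate signature fixed; the two recursions differ by an exchange of sums.
\<close>

lemma strips_op_eq_sum:
  "mu \<in> Weyl n \<Longrightarrow> strips_op p r n m f mu = (\<Sum>lam\<in>lifts n m mu. strips_weight p r n m lam mu * f lam)"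
proof (induction m arbitrary: f)
  case 0
  have "lam = mu" if "lam \<in> lifts n 0 mu" for lam
    using that Weyl_ext[OF 0] by (intro extensionalityI[of lam "{1..n}" mu]) (auto simp: lifts_def PiE_iff)
  moreover have "mu \<in> lifts n 0 mu" using 0 Weyl_ext[OF 0] by (simp add: lifts_def PiE_iff)
  ultimately have "lifts n 0 mu = {mu}" by blast
  then show ?case by simp
next
  case (Suc m)
  let ?c = "p (Suc (r + m))"
  let ?g = "\<lambda>lam kap. strips_weight p r n m kap mu * ((\<Prod>i=1..n. ?c powi (lam i - kap i)) * f lam)"
  have "strips_op p r n (Suc m) f mu = (\<Sum>kap\<in>lifts n m mu. \<Sum>lam\<in>strip n 1 kap. ?g lam kap)"
    unfolding strips_op.simps Suc.IH[OF Suc.prems] strip_op_def by (simp add: sum_distrib_left)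
  also have "\<dots> = (\<Sum>lam\<in>lifts n (Suc m) mu. \<Sum>kap\<in>strip n (-1) lam. ?g lam kap)"
  proof (rule sum_swap_dependent)
    fix kap lam assume *: "kap \<in> lifts n m mu" "lam \<in> strip n 1 kap"
    have "kap \<in> Weyl n" "lam \<in> Weyl n" using * by (auto simp: lifts_def strip_def)
    moreover from this * have "kap \<in> strip n (-1) lam" using strip_sym[of kap n lam 1] by simp
    moreover have "lam i \<in> {mu i..mu i + int (Suc m)}" if "i \<in> {1..n}" for i
    proof -
      have "kap i \<in> {mu i..mu i + int m}" using * that by (auto simp: lifts_def PiE_iff)
      then show ?thesis using that strip_cases[OF *(2), of i] by auto
    qed
    ultimately show "lam \<in> lifts n (Suc m) mu \<and> kap \<in> strip n (-1) lam"
      using Weyl_ext[of lam n] by (auto simp: lifts_def PiE_iff)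
  next
    fix kap lam assume *: "lam \<in> lifts n (Suc m) mu" "kap \<in> strip n (-1) lam" "?g lam kap \<noteq> 0"
    then have "kap \<in> Weyl n" "lam \<in> Weyl n" by (auto simp: lifts_def strip_def)
    with * show "kap \<in> lifts n m mu \<and> lam \<in> strip n 1 kap"
      using strips_weight_lifts[of p r n m kap mu] strip_sym[of kap n lam 1] by auto
  qed auto
  also have "\<dots> = (\<Sum>lam\<in>lifts n (Suc m) mu. strips_weight p r n (Suc m) lam mu * f lam)"
    by (simp add: sum_distrib_left sum_distrib_right mult_ac)
  finally show ?case .
qed

lemma strips_op_cong:
  assumes "mu \<in> Weyl n" "\<And>lam. lam \<in> Weyl n \<Longrightarrow> f lam = g lam"
  shows "strips_op p r n m f mu = strips_op p r n m g mu"
  unfolding strips_op_eq_sum[OF assms(1)] using assms(2) by (intro sum.cong) (auto simp: lifts_def)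

lemma strips_op_linear:
  assumes "mu \<in> Weyl n"
  shows "strips_op p r n m (\<lambda>lam. \<Sum>z\<in>I. c z * f z lam) mu = (\<Sum>z\<in>I. c z * strips_op p r n m (f z) mu)"
  unfolding strips_op_eq_sum[OF assms] sum_distrib_left
  by (subst sum.swap) (simp add: mult_ac)

text \<open>
  The rows of length \<open>n + 1\<close> from which the first signed step leads to \<open>kap\<close>; the last entry \<open>c\<close> belongs
  to the trivial path.
\<close>

definition descents :: "nat \<Rightarrow> int \<Rightarrow> (nat \<Rightarrow> int) \<Rightarrow> (nat \<Rightarrow> int) set" where
  "descents n c kap = {mu \<in> Weyl (Suc n). (\<forall>i\<in>{1..n}. mu i \<in> {kap i - 1, kap i}) \<and> mu (Suc n) = c}"

lemma finite_descents [simp]: "finite (descents n c kap)"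
proof (rule finite_subset)
  show "descents n c kap \<subseteq> (\<Pi>\<^sub>E i\<in>{1..Suc n}. if i = Suc n then {c} else {kap i - 1, kap i})"
  proof
    fix mu assume "mu \<in> descents n c kap"
    then show "mu \<in> (\<Pi>\<^sub>E i\<in>{1..Suc n}. if i = Suc n then {c} else {kap i - 1, kap i})"
      using Weyl_ext[of mu "Suc n"] by (auto simp: descents_def PiE_iff)
  qed
qed (auto intro!: finite_PiE)

text \<open>
  For \<open>n = 0\<close> the function that is undefined everywhere is the only signature.
\<close>

fun inverse_op :: "(nat \<Rightarrow> real) \<Rightarrow> nat \<Rightarrow> (nat \<Rightarrow> int) \<Rightarrow> ((nat \<Rightarrow> int) \<Rightarrow> real) \<Rightarrow> real" where
  "inverse_op q 0 y f = f (\<lambda>_. undefined)"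
| "inverse_op q (Suc n) y f = inverse_op q n y (\<lambda>kap. \<Sum>mu\<in>descents n (y (Suc n)) kap.
     (\<Prod>i=1..n. (- q (Suc n)) powi (kap i - mu i)) * f mu)"

lemma Weyl_0: "Weyl 0 = {\<lambda>_. undefined}"
  by (auto simp: Weyl_def)

lemma inverse_op_eq_sum:
  "inverse_op q n y f = (\<Sum>mu\<in>drops n y. inverse_weight q n y mu * f mu)"
proof (induction n arbitrary: f)
  case 0
  then show ?case by (simp add: drops_def Weyl_0)
next
  case (Suc n)
  let ?q = "- q (Suc n)"
  let ?g = "\<lambda>mu kap. inverse_weight q n y kap * ((\<Prod>i=1..n. ?q powi (kap i - mu i)) * f mu)"
  let ?X = "{mu \<in> drops (Suc n) y. mu (Suc n) = y (Suc n)}"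
  have "inverse_op q (Suc n) y f = (\<Sum>kap\<in>drops n y. \<Sum>mu\<in>descents n (y (Suc n)) kap. ?g mu kap)"
    unfolding inverse_op.simps Suc.IH by (simp add: sum_distrib_left)
  also have "\<dots> = (\<Sum>mu\<in>?X. \<Sum>kap\<in>strip n 1 mu. ?g mu kap)"
  proof (rule sum_swap_dependent)
    fix kap mu assume *: "kap \<in> drops n y" "mu \<in> descents n (y (Suc n)) kap"
    then have mu: "mu \<in> Weyl (Suc n)" and kap: "kap \<in> Weyl n" and c: "mu (Suc n) = y (Suc n)"
      by (auto simp: descents_def drops_def)
    have "mu i \<in> {y i - int (Suc n)..y i}" if "i \<in> {1..Suc n}" for i
    proof (cases "i = Suc n")
      case False
      then have "i \<in> {1..n}" using that by auto
      then show ?thesis using * that by (force simp: drops_def descents_def PiE_iff)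
    qed (simp add: c)
    with mu have "mu \<in> drops (Suc n) y" using Weyl_ext[of mu "Suc n"] by (auto simp: drops_def PiE_iff)
    moreover have "kap \<in> strip n 1 mu" using * kap Weyl_ext[of kap n]
      by (auto simp: descents_def strip_def PiE_iff)
    ultimately show "mu \<in> ?X \<and> kap \<in> strip n 1 mu" using c by simp
  next
    fix kap mu assume *: "mu \<in> ?X" "kap \<in> strip n 1 mu" "?g mu kap \<noteq> 0"
    then have kap: "kap \<in> Weyl n" "inverse_weight q n y kap \<noteq> 0" by (auto simp: strip_def)
    then have "kap \<in> drops n y" using inverse_weight_drops by blast
    moreover have "mu \<in> descents n (y (Suc n)) kap"
      using * by (auto simp: drops_def descents_def strip_def PiE_iff)
    ultimately show "kap \<in> drops n y \<and> mu \<in> descents n (y (Suc n)) kap" by simp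
  qed auto
  also have "\<dots> = (\<Sum>mu\<in>?X. inverse_weight q (Suc n) y mu * f mu)"
    by (intro sum.cong) (auto simp: sum_distrib_left sum_distrib_right mult_ac)
  also have "\<dots> = (\<Sum>mu\<in>drops (Suc n) y. inverse_weight q (Suc n) y mu * f mu)"
    by (intro sum.mono_neutral_left) auto
  finally show ?case .
qed

lemma inverse_op_cong:
  assumes "\<And>mu. mu \<in> Weyl n \<Longrightarrow> (n \<ge> 1 \<Longrightarrow> mu n = y n) \<Longrightarrow> f mu = g mu"
  shows "inverse_op q n y f = inverse_op q n y g"
  unfolding inverse_op_eq_sum
proof (intro sum.cong refl)
  fix mu assume "mu \<in> drops n y"
  then show "inverse_weight q n y mu * f mu = inverse_weight q n y mu * g mu"
    using assms[of mu] by (cases n) (auto simp: drops_def)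
qed

lemma inverse_op_linear:
  "inverse_op q n y (\<lambda>lam. \<Sum>z\<in>I. c z * f z lam) = (\<Sum>z\<in>I. c z * inverse_op q n y (f z))"
  unfolding inverse_op_eq_sum sum_distrib_left
  by (subst sum.swap) (simp add: mult_ac)

section \<open>Inverting the Gelfand-Tsetlin weights\<close>

lemma sum_filtered_pair:
  fixes f :: "int \<Rightarrow> real"
  assumes "u \<noteq> v"
  shows "(\<Sum>m\<in>{m \<in> {u, v}. P m}. f m) = of_bool (P u) * f u + of_bool (P v) * f v"
proof -
  have "(\<Sum>m\<in>{m \<in> {u, v}. P m}. f m) = (\<Sum>m\<in>{u, v}. if P m then f m else 0)"
    by (rule sum.inter_filter) simp
  then show ?thesis using assms by simp
qed

lemma gt_weight_cong:
  "(\<And>i. 1 \<le> i \<Longrightarrow> i \<le> n \<Longrightarrow> y i = z i) \<Longrightarrow> gt_weight q n lam y = gt_weight q n lam z"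
  by (induction n arbitrary: lam) auto

lemma prod_1_Suc: "(\<Prod>i=1..Suc n. f i) = (\<Prod>i=1..n. f i) * (f (Suc n) :: real)"
  by simp

text \<open>
  The sum factors over the coordinates. In a coordinate where both \<open>kap i - 1\<close> and \<open>kap i\<close> are allowed
  the two terms cancel, so it suffices to look at the first coordinate in which \<open>k\<close> and \<open>kap\<close> differ:
  there the upper bound \<open>k (i - 1) = kap (i - 1)\<close> is no restriction, and depending on the sign of
  \<open>k i - kap i\<close> either both values or none are allowed.
\<close>

lemma signed_descend_sum:
  assumes kap: "kap \<in> Weyl n" and k: "k \<in> Weyl n" and c: "n \<ge> 1 \<Longrightarrow> c \<le> kap n"
  shows "(\<Sum>mu\<in>{mu \<in> descents n c kap. k \<in> interlacing n mu}.
            \<Prod>i=1..n. (-1) powi (kap i - mu i)) = (of_bool (k = kap) :: real)"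
proof -
  define S where "S i = {m \<in> {kap i - 1, kap i}. k i \<le> m \<and> (i > 1 \<longrightarrow> m \<le> k (i - 1))}" for i
  define S' where "S' = {m \<in> {c}. n \<ge> 1 \<longrightarrow> c \<le> k n}"
  define f where "f i m = (if i = Suc n then 1 else (-1 :: real) powi (kap i - m))" for i m
  have "{mu \<in> descents n c kap. k \<in> interlacing n mu}
      = (\<Pi>\<^sub>E i\<in>{1..Suc n}. if i = Suc n then S' else S i)" (is "?A = ?B")
  proof (intro equalityI subsetI)
    fix mu assume "mu \<in> ?A"
    then have mu: "mu \<in> descents n c kap" and il: "k \<in> interlacing n mu" by auto
    have "mu i \<in> (if i = Suc n then S' else S i)" if "i \<in> {1..Suc n}" for i
    proof (cases "i = Suc n")
      case True
      then show ?thesis using mu interlacing_bounds[OF il, of n] by (auto simp: S'_def descents_def)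
    next
      case False
      then have i: "1 \<le> i" "i \<le> n" using that by auto
      have "mu i \<le> k (i - 1)" if "i > 1"
        using interlacing_bounds[OF il, of "i - 1"] that i by simp
      then show ?thesis using False mu i interlacing_bounds[OF il i] by (auto simp: S_def descents_def)
    qed
    moreover have "mu \<in> extensional {1..Suc n}" using mu Weyl_ext by (simp add: descents_def)
    ultimately show "mu \<in> ?B" by (auto simp: PiE_iff)
  next
    fix mu assume B: "mu \<in> ?B"
    have last: "mu (Suc n) = c" and cn: "n \<ge> 1 \<Longrightarrow> c \<le> k n"
      using PiE_mem[OF B, of "Suc n"] by (auto simp: S'_def)
    have S: "mu i \<in> S i" if "1 \<le> i" "i \<le> n" for i
      using PiE_mem[OF B, of i] that by auto
    have step: "mu (Suc i) \<le> k i" if "1 \<le> i" "i \<le> n" for i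
      using that S[of "Suc i"] last cn by (cases "i = n") (auto simp: S_def)
    have il: "k \<in> interlacing n mu"
      using Weyl_ext[OF k] step S by (auto simp: interlacing_def PiE_iff S_def)
    have "mu \<in> Weyl (Suc n)"
    proof (rule WeylI_adjacent)
      show "mu \<in> {1..Suc n} \<rightarrow>\<^sub>E UNIV" using B by (auto simp: PiE_iff)
      fix i assume "1 \<le> i" "i < Suc n"
      then show "mu (Suc i) \<le> mu i" using interlacing_bounds[OF il, of i] by linarith
    qed
    with il show "mu \<in> ?A" using S last by (auto simp: descents_def S_def)
  qed
  then have "(\<Sum>mu\<in>?A. \<Prod>i=1..n. (-1) powi (kap i - mu i)) = (\<Sum>mu\<in>?B. \<Prod>i=1..Suc n. f i (mu i))"
    by (intro sum.cong) (auto simp: f_def intro!: prod.cong)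
  also have "\<dots> = (\<Prod>i=1..Suc n. \<Sum>m\<in>(if i = Suc n then S' else S i). f i m)"
    by (intro prod_sum_PiE[symmetric]) (auto simp: S_def S'_def)
  also have "\<dots> = (\<Prod>i=1..n. \<Sum>m\<in>S i. (-1) powi (kap i - m)) * of_bool (n \<ge> 1 \<longrightarrow> c \<le> k n)"
    by (simp add: f_def S'_def)
  also have "\<dots> = of_bool (k = kap)"
  proof (cases "k = kap")
    case True
    have "S i = {kap i}" if "i \<in> {1..n}" for i
      using that Weyl_mono[OF kap, of "i - 1" i] unfolding S_def True by auto
    then show ?thesis using True c by simp
  next
    case False
    then have ex: "\<exists>i. i \<in> {1..n} \<and> k i \<noteq> kap i"
      using extensionalityI[of k "{1..n}" kap] Weyl_ext[OF k] Weyl_ext[OF kap] by blast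
    define i where "i = (LEAST i. i \<in> {1..n} \<and> k i \<noteq> kap i)"
    have i: "i \<in> {1..n}" "k i \<noteq> kap i" using LeastI_ex[OF ex] by (auto simp: i_def)
    have least: "k j = kap j" if "j < i" "j \<in> {1..n}" for j
      using not_less_Least[of j "\<lambda>i. i \<in> {1..n} \<and> k i \<noteq> kap i"] that by (auto simp: i_def)
    have up: "i > 1 \<longrightarrow> kap i \<le> k (i - 1)"
    proof
      assume "i > 1"
      then have "1 \<le> i - 1" "i - 1 \<le> n" "i - 1 < i" "i \<le> n" using i(1) by auto
      then show "kap i \<le> k (i - 1)" using least[of "i - 1"] Weyl_mono[OF kap, of "i - 1" i] by simp
    qed
    have "(\<Sum>m\<in>S i. (-1 :: real) powi (kap i - m)) = 0"
    proof (cases "k i \<le> kap i - 1")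
      case True
      then have "S i = {kap i - 1, kap i}" using up by (auto simp: S_def)
      then show ?thesis by simp
    next
      case False
      then have "S i = {}" using i by (auto simp: S_def)
      then show ?thesis by simp
    qed
    then have "(\<Prod>i=1..n. \<Sum>m\<in>S i. (-1 :: real) powi (kap i - m)) = 0"
      using i(1) by (intro prod_zero) auto
    then show ?thesis using False by simp
  qed
  finally show ?thesis .
qed

text \<open>
  One row of \<open>B A = 1\<close>. The powers of \<open>q (n + 1)\<close> of the signed step and of the last row of the pattern
  combine to a factor that is independent of \<open>mu\<close>, which leaves the signed sum above.
\<close>

lemma descend_gt_weight:
  assumes kap: "kap \<in> Weyl n" and c: "n \<ge> 1 \<Longrightarrow> c \<le> kap n" and q: "q (Suc n) > 0"
  shows "(\<Sum>mu\<in>descents n c kap. (\<Prod>i=1..n. (- q (Suc n)) powi (kap i - mu i)) * gt_weight q (Suc n) mu y)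
    = of_bool (c = y (Suc n)) * gt_weight q n kap y"
proof (cases "c = y (Suc n)")
  case False
  then show ?thesis by (auto simp: descents_def intro!: sum.neutral)
next
  case True
  let ?q = "q (Suc n)"
  define D where "D = descents n c kap"
  define Y where "Y = insert kap (\<Union>mu\<in>D. interlacing n mu)"
  have YW: "k \<in> Weyl n" if "k \<in> Y" for k
    using that kap interlacing_Weyl by (auto simp: Y_def)
  let ?s = "\<lambda>mu. \<Prod>i=1..n. (-1 :: real) powi (kap i - mu i)"
  let ?w = "\<lambda>mu k. ?s mu * ((\<Prod>i=1..n. ?q powi (kap i - k i)) * gt_weight q n k y)"
  have w: "(\<Prod>i=1..n. (- ?q) powi (kap i - mu i)) * ((\<Prod>i=1..n. ?q powi (mu i - k i)) * gt_weight q n k y)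
    = ?w mu k" for mu k
  proof -
    have "(- ?q) powi (kap i - mu i) * ?q powi (mu i - k i) = (-1) powi (kap i - mu i) * ?q powi (kap i - k i)" for i
    proof -
      have "(- ?q) powi (kap i - mu i) = (-1) powi (kap i - mu i) * ?q powi (kap i - mu i)"
        using power_int_mult_distrib[of "-1" ?q "kap i - mu i"] by simp
      moreover have "?q powi (kap i - k i) = ?q powi (kap i - mu i) * ?q powi (mu i - k i)"
        using q by (simp flip: power_int_add)
      ultimately show ?thesis by simp
    qed
    then show ?thesis by (simp add: mult.assoc[symmetric] flip: prod.distrib)
  qed
  have "(\<Sum>mu\<in>D. (\<Prod>i=1..n. (- ?q) powi (kap i - mu i)) * gt_weight q (Suc n) mu y)
      = (\<Sum>mu\<in>D. \<Sum>k\<in>interlacing n mu. ?w mu k)"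
  proof (rule sum.cong[OF refl])
    fix mu assume "mu \<in> D"
    then have "mu (Suc n) = y (Suc n)" by (simp add: D_def descents_def True)
    then show "(\<Prod>i=1..n. (- ?q) powi (kap i - mu i)) * gt_weight q (Suc n) mu y
        = (\<Sum>k\<in>interlacing n mu. ?w mu k)"
      by (simp only: gt_weight.simps simp_thms if_True sum_distrib_left w)
  qed
  also have "\<dots> = (\<Sum>k\<in>Y. \<Sum>mu\<in>{mu \<in> D. k \<in> interlacing n mu}. ?w mu k)"
    by (rule sum_swap_dependent) (auto simp: Y_def D_def)
  also have "\<dots> = (\<Sum>k\<in>Y. of_bool (k = kap) * ((\<Prod>i=1..n. ?q powi (kap i - k i)) * gt_weight q n k y))"
  proof (rule sum.cong[OF refl])
    fix k assume "k \<in> Y"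
    then show "(\<Sum>mu\<in>{mu \<in> D. k \<in> interlacing n mu}. ?w mu k)
      = of_bool (k = kap) * ((\<Prod>i=1..n. ?q powi (kap i - k i)) * gt_weight q n k y)"
      unfolding sum_distrib_right[symmetric] D_def using signed_descend_sum[OF kap YW c] by simp
  qed
  also have "\<dots> = (\<Sum>k\<in>{kap}. (\<Prod>i=1..n. ?q powi (kap i - k i)) * gt_weight q n k y)"
    by (rule sum.mono_neutral_cong_right) (auto simp: Y_def D_def)
  finally show ?thesis by (simp add: D_def True)
qed

text \<open>
  The matrix identity \<open>B A = 1\<close>, by peeling off one row at a time. The operator only looks at signatures
  whose last entry agrees with \<open>y\<close>, and this supplies the bound on \<open>kap n\<close> that the one-row identity
  needs.
\<close>

lemma inverse_op_gt_weight:
  assumes "y \<in> Weyl n" "\<And>i. 1 \<le> i \<Longrightarrow> i \<le> n \<Longrightarrow> q i > 0"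
  shows "inverse_op q n y (\<lambda>mu. gt_weight q n mu y') = of_bool (\<forall>i\<in>{1..n}. y i = y' i)"
  using assms
proof (induction n arbitrary: y)
  case (Suc n)
  define z where "z = restrict y {1..n}"
  have z: "z \<in> Weyl n" and zi: "\<And>i. 1 \<le> i \<Longrightarrow> i \<le> n \<Longrightarrow> z i = y i"
    using Suc.prems(1) by (auto simp: z_def Weyl_def)
  have zB: "inverse_op q n y f = inverse_op q n z f" for f
  proof -
    have "m \<le> n \<Longrightarrow> inverse_op q m y f = inverse_op q m z f" for m f
      by (induction m arbitrary: f) (simp_all add: zi)
    then show ?thesis by simp
  qed
  have "inverse_op q (Suc n) y (\<lambda>mu. gt_weight q (Suc n) mu y')
     = inverse_op q n z (\<lambda>kap. of_bool (y (Suc n) = y' (Suc n)) * gt_weight q n kap y')"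
    unfolding inverse_op.simps zB
  proof (rule inverse_op_cong)
    fix kap assume kap: "kap \<in> Weyl n" "n \<ge> 1 \<Longrightarrow> kap n = z n"
    have "y (Suc n) \<le> kap n" if "n \<ge> 1"
      using kap(2)[OF that] zi[of n] that Weyl_mono[OF Suc.prems(1), of n "Suc n"] by simp
    then show "(\<Sum>mu\<in>descents n (y (Suc n)) kap. (\<Prod>i=1..n. (- q (Suc n)) powi (kap i - mu i))
         * gt_weight q (Suc n) mu y') = of_bool (y (Suc n) = y' (Suc n)) * gt_weight q n kap y'"
      using kap Suc.prems(2) by (intro descend_gt_weight) auto
  qed
  also have "\<dots> = of_bool (y (Suc n) = y' (Suc n)) * inverse_op q n z (\<lambda>kap. gt_weight q n kap y')"
    using inverse_op_linear[where q = q and n = n and y = z and I = "{0::nat}"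
        and c = "\<lambda>_. of_bool (y (Suc n) = y' (Suc n))" and f = "\<lambda>_ kap. gt_weight q n kap y'"]
    by simp
  also have "\<dots> = of_bool (\<forall>i\<in>{1..Suc n}. y i = y' i)"
    using Suc.IH[OF z] Suc.prems(2) zi by (auto simp: atLeastAtMostSuc_conv)
  finally show ?case .
qed simp

text \<open>
  Let particle \<open>k - 1\<close> have the new position \<open>y (k - 1)\<close>. With jump parameter \<open>c\<close>, this is the
  probability that particle \<open>k\<close> goes from \<open>x k\<close> to \<open>y k\<close>, multiplied by the normalisation \<open>1 + c q_k\<close> and
  by \<open>q_k^(x_k - y_k)\<close>.
\<close>

definition step_factor :: "real \<Rightarrow> (nat \<Rightarrow> real) \<Rightarrow> (nat \<Rightarrow> int) \<Rightarrow> (nat \<Rightarrow> int) \<Rightarrow> nat \<Rightarrow> real" where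
  "step_factor c q x y k = (let f = (\<lambda>w. if k = 1 then x k + w else min (y (k - 1)) (x k + w))
     in q k powi (x k - y k) * (of_bool (f 0 = y k) + c * q k * of_bool (f 1 = y k)))"

section \<open>Intertwining one time step with the patterns\<close>

text \<open>
  The factor on the left counts the admissible values of one coordinate of \<open>kap\<close>, the one on the right
  those of one coordinate of \<open>lam\<close>. If the upper bound on \<open>b\<close> leaves both values open the identity is
  trivial; if it leaves only one, that is \<open>b = u + 1\<close>, then \<open>b \<le> A\<close> and \<open>v \<le> u\<close> make the two lower
  bounds vacuous.
\<close>

lemma local_exchange:
  fixes x :: real and A b u v :: int
  assumes "b \<le> A" "v \<le> u"
  shows "(of_bool (v \<le> b \<and> b \<le> u) + x * of_bool (v \<le> b - 1 \<and> b - 1 \<le> u)) * (of_bool (u \<le> A) + x * of_bool (u + 1 \<le> A))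
    = (of_bool (b \<le> u \<and> u \<le> A) + x * of_bool (b \<le> u + 1 \<and> u + 1 \<le> A)) * (of_bool (v \<le> b) + x * of_bool (v + 1 \<le> b))"
proof -
  consider "b \<le> u" | "b = u + 1" | "b > u + 1" by linarith
  then show ?thesis
  proof cases
    case 1
    then have "b \<le> u \<longleftrightarrow> True" "b - 1 \<le> u \<longleftrightarrow> True" "b \<le> u + 1 \<longleftrightarrow> True" "v + 1 \<le> b \<longleftrightarrow> v \<le> b - 1" by auto
    then show ?thesis by (simp only: simp_thms mult.commute)
  next
    case 2
    with assms show ?thesis by simp
  next
    case 3
    with assms show ?thesis by simp
  qed
qed

lemma mult_exchange:
  fixes a b c d e f g :: "'a :: comm_ring_1"
  assumes "a * b = c * d" "e * d = f * g"
  shows "a * (b * e) = (c * f) * g"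
proof -
  have "a * (b * e) = (a * b) * e" by (rule mult.assoc[symmetric])
  also have "\<dots> = c * (e * d)" unfolding assms(1) by (simp only: mult_ac)
  also have "\<dots> = (c * f) * g" unfolding assms(2) by (rule mult.assoc[symmetric])
  finally show ?thesis .
qed

text \<open>
  Multiplying the local identity over the first \<open>j\<close> coordinates, the last factor of one step being the
  first of the next. The bound on \<open>K 0\<close> makes it act as infinity: there is no row entry above the
  first coordinate.
\<close>

lemma exchange_prefix:
  fixes K nu :: "nat \<Rightarrow> int" and x :: real
  assumes K: "\<And>i. i < n \<Longrightarrow> K (Suc i) \<le> K i" and nu: "\<And>i. 1 \<le> i \<Longrightarrow> i \<le> n \<Longrightarrow> nu (Suc i) \<le> nu i"
    and K0: "nu 1 + 1 \<le> K 0" and "j \<le> n"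
  shows "(1 + x) * (\<Prod>i=1..j. of_bool (nu (Suc i) \<le> K i \<and> K i \<le> nu i)
                       + x * of_bool (nu (Suc i) \<le> K i - 1 \<and> K i - 1 \<le> nu i))
    = (\<Prod>i=1..j. of_bool (K i \<le> nu i \<and> nu i \<le> K (i - 1))
                       + x * of_bool (K i \<le> nu i + 1 \<and> nu i + 1 \<le> K (i - 1)))
      * (of_bool (nu (Suc j) \<le> K j) + x * of_bool (nu (Suc j) + 1 \<le> K j))"
  (is "(1 + x) * (\<Prod>i=1..j. ?R i) = (\<Prod>i=1..j. ?L i) * ?c j")
  using \<open>j \<le> n\<close>
proof (induction j)
  case 0
  then show ?case using K0 by simp
next
  case (Suc j)
  have "?R (Suc j) * ?c j = ?L (Suc j) * ?c (Suc j)"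
    using local_exchange[of "K (Suc j)" "K j" "nu (Suc (Suc j))" "nu (Suc j)" x]
      K[of j] nu[of "Suc j"] Suc.prems by simp
  moreover have "(1 + x) * (\<Prod>i=1..j. ?R i) = (\<Prod>i=1..j. ?L i) * ?c j"
    using Suc by simp
  ultimately show ?case unfolding prod_1_Suc by (rule mult_exchange[rotated])
qed

text \<open>
  The factor left over after the first \<open>n\<close> coordinates combines with the move of the last particle,
  which is free if \<open>u < A\<close> and blocked if \<open>u = A\<close>, to the factor of the last part of \<open>lam\<close>. For \<open>A < u\<close> both
  sides vanish.
\<close>

lemma last_exchange:
  fixes A u a :: int and c Q :: real
  assumes "Q > 0"
  shows "(of_bool (u \<le> A) + c * Q * of_bool (u + 1 \<le> A))
       * (Q powi (u - a) * (of_bool (min A u = a) + c * Q * of_bool (min A (u + 1) = a)))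
     = (1 + c * Q) * (of_bool (u \<le> A \<and> u = a) + c * of_bool (u + 1 \<le> A \<and> u + 1 = a))"
proof -
  consider "u + 1 \<le> A" | "u = A" | "A < u" by linarith
  then show ?thesis
  proof cases
    case 1
    then have *: "min A u = u" "min A (u + 1) = u + 1" by auto
    show ?thesis
    proof (cases "a = u + 1")
      case True
      then have "Q powi (u - a) * Q = 1" using assms by (simp add: power_int_minus)
      then show ?thesis unfolding * using 1 True by simp
    next
      case False
      then show ?thesis unfolding * using 1 by auto
    qed
  next
    case 2
    then show ?thesis by auto
  next
    case 3
    then show ?thesis by auto
  qed
qed

lemma step_factor_cong: "x k = z k \<Longrightarrow> step_factor c q x y k = step_factor c q z y k"
  by (simp only: step_factor_def)

text \<open>
  The dual skew Cauchy identity for one variable, with the last part of \<open>lam\<close> prescribed. For a given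
  lower row \<open>k\<close> interlacing only compares single coordinates with \<open>k\<close> and \<open>nu\<close>, so both index sets are
  products of sets with at most two elements and both sums are products over the coordinates. Once the
  common factor \<open>\<Prod>Q^(nu_i - k_i)\<close> is removed, the two possible values of each of the first \<open>n\<close>
  coordinates contribute \<open>1\<close> and \<open>c Q\<close>, as far as interlacing admits them.
\<close>

lemma dual_cauchy_one_step:
  fixes c Q :: real
  assumes nu: "nu \<in> Weyl (Suc n)" and k: "k \<in> Weyl n" and c: "c > 0" and Q: "Q > 0"
  shows "(\<Sum>lam\<in>{lam \<in> strip (Suc n) 1 nu. lam (Suc n) = a \<and> k \<in> interlacing n lam}.
            (\<Prod>i=1..Suc n. c powi (lam i - nu i)) * (\<Prod>i=1..n. Q powi (lam i - k i)))
    = (\<Sum>kap\<in>{kap \<in> interlacing n nu. k \<in> strip n 1 kap}.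
            (\<Prod>i=1..n. Q powi (nu i - kap i)) * (\<Prod>i=1..n. c powi (k i - kap i)))
      * (let f = (\<lambda>w. if n = 0 then nu (Suc n) + w else min (k n) (nu (Suc n) + w))
         in Q powi (nu (Suc n) - a) * (of_bool (f 0 = a) + c * Q * of_bool (f 1 = a)))"
    (is "?lhs = ?rhs * ?g")
proof -
  (* A virtual entry above the first one; by the maximum it bounds every value it is
     compared with and K stays decreasing. *)
  define K where "K i = (if i = 0 then max (nu 1 + 1) (k 1) else k i)" for i
  define x where "x = c * Q"
  have x: "x > 0" unfolding x_def using c Q by (rule mult_pos_pos)
  define S where "S i = {m \<in> {nu i, nu i + 1}. K i \<le> m \<and> m \<le> K (i - 1)}" for i
  define S' where "S' = {m \<in> {nu (Suc n), nu (Suc n) + 1}. m \<le> K n \<and> m = a}"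
  define R where "R i = {m \<in> {k i - 1, k i}. nu (Suc i) \<le> m \<and> m \<le> nu i}" for i
  define L' where "L' = (\<Sum>m\<in>S'. c powi (m - nu (Suc n)))"
  define f where "f i m = (if i = Suc n then c powi (m - nu i) else c powi (m - nu i) * Q powi (m - k i))" for i m

  have "{lam \<in> strip (Suc n) 1 nu. lam (Suc n) = a \<and> k \<in> interlacing n lam}
      = (\<Pi>\<^sub>E i\<in>{1..Suc n}. if i = Suc n then S' else S i)" (is "?A = ?B")
  proof (intro equalityI subsetI)
    fix lam assume "lam \<in> ?A"
    then have lam: "lam \<in> strip (Suc n) 1 nu" and la: "lam (Suc n) = a" and il: "k \<in> interlacing n lam" by auto
    have "lam i \<in> (if i = Suc n then S' else S i)" if i: "i \<in> {1..Suc n}" for i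
    proof -
      have "lam i \<le> K (i - 1)"
      proof (cases "i = 1")
        case True
        then show ?thesis using strip_cases[OF lam, of 1] by (auto simp: K_def)
      next
        case False
        then show ?thesis using i interlacing_bounds[OF il, of "i - 1"] by (auto simp: K_def)
      qed
      then show ?thesis using i la strip_cases[OF lam, of i] interlacing_bounds[OF il, of i]
        by (auto simp: S_def S'_def K_def)
    qed
    moreover have "lam \<in> extensional {1..Suc n}" using strip_Weyl[OF lam] Weyl_ext by blast
    ultimately show "lam \<in> ?B" by (auto simp: PiE_iff)
  next
    fix lam assume B: "lam \<in> ?B"
    have last: "lam (Suc n) \<in> S'" using PiE_mem[OF B, of "Suc n"] by auto
    have S: "lam i \<in> S i" if "1 \<le> i" "i \<le> n" for i
      using PiE_mem[OF B, of i] that by auto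
    have step: "lam (Suc i) \<le> k i" if "1 \<le> i" "i \<le> n" for i
      using that S[of "Suc i"] last by (cases "i = n") (auto simp: S_def S'_def K_def)
    have il: "k \<in> interlacing n lam"
      using Weyl_ext[OF k] step S by (auto simp: interlacing_def PiE_iff S_def K_def)
    have "lam \<in> Weyl (Suc n)"
    proof (rule WeylI_adjacent)
      show "lam \<in> {1..Suc n} \<rightarrow>\<^sub>E UNIV" using B by (auto simp: PiE_iff)
      fix i assume "1 \<le> i" "i < Suc n"
      then show "lam (Suc i) \<le> lam i" using interlacing_bounds[OF il, of i] by linarith
    qed
    moreover have "lam i \<in> {nu i, nu i + 1}" if "i \<in> {1..Suc n}" for i
      using that S[of i] last by (cases "i = Suc n") (auto simp: S_def S'_def)
    ultimately have "lam \<in> strip (Suc n) 1 nu" using Weyl_ext by (simp add: strip_def PiE_iff)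
    with il show "lam \<in> ?A" using last by (auto simp: S'_def)
  qed
  then have "?lhs = (\<Sum>lam\<in>?B. \<Prod>i=1..Suc n. f i (lam i))"
  proof (rule sum.cong)
    fix lam
    show "(\<Prod>i=1..Suc n. c powi (lam i - nu i)) * (\<Prod>i=1..n. Q powi (lam i - k i))
        = (\<Prod>i=1..Suc n. f i (lam i))"
      unfolding prod_1_Suc by (simp add: f_def prod.distrib)
  qed
  also have "\<dots> = (\<Prod>i=1..Suc n. \<Sum>m\<in>(if i = Suc n then S' else S i). f i m)"
    by (intro prod_sum_PiE[symmetric]) (auto simp: S_def S'_def)
  also have "\<dots> = (\<Prod>i=1..n. \<Sum>m\<in>S i. c powi (m - nu i) * Q powi (m - k i)) * L'"
    by (simp add: f_def L'_def)
  also have "(\<Prod>i=1..n. \<Sum>m\<in>S i. c powi (m - nu i) * Q powi (m - k i))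
      = (\<Prod>i=1..n. Q powi (nu i - k i)) *
        (\<Prod>i=1..n. of_bool (K i \<le> nu i \<and> nu i \<le> K (i - 1))
                       + x * of_bool (K i \<le> nu i + 1 \<and> nu i + 1 \<le> K (i - 1)))"
    unfolding prod.distrib[symmetric]
  proof (rule prod.cong[OF refl])
    fix i
    have "Q powi (nu i + 1 - k i) = Q powi (nu i - k i) * Q"
      using power_int_add_1[of Q "nu i - k i"] Q by (simp add: algebra_simps)
    then show "(\<Sum>m\<in>S i. c powi (m - nu i) * Q powi (m - k i))
      = Q powi (nu i - k i) * (of_bool (K i \<le> nu i \<and> nu i \<le> K (i - 1))
                       + x * of_bool (K i \<le> nu i + 1 \<and> nu i + 1 \<le> K (i - 1)))"
      unfolding S_def by (subst sum_filtered_pair) (simp_all add: x_def algebra_simps)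
  qed
  finally have lhs: "?lhs = (\<Prod>i=1..n. Q powi (nu i - k i)) *
        (\<Prod>i=1..n. of_bool (K i \<le> nu i \<and> nu i \<le> K (i - 1))
                       + x * of_bool (K i \<le> nu i + 1 \<and> nu i + 1 \<le> K (i - 1))) * L'" .

  have "{kap \<in> interlacing n nu. k \<in> strip n 1 kap} = (\<Pi>\<^sub>E i\<in>{1..n}. R i)" (is "?C = ?D")
  proof (intro equalityI subsetI)
    fix kap assume "kap \<in> ?C"
    then have il: "kap \<in> interlacing n nu" and ad: "k \<in> strip n 1 kap" by auto
    have "kap i \<in> R i" if "i \<in> {1..n}" for i
      using that interlacing_bounds[OF il, of i] strip_cases[OF ad, of i] by (auto simp: R_def)
    then show "kap \<in> ?D" using il by (auto simp: interlacing_def PiE_iff)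
  next
    fix kap assume D: "kap \<in> ?D"
    then have "kap \<in> interlacing n nu" by (auto simp: interlacing_def PiE_iff R_def)
    moreover have "k i \<in> {kap i, kap i + 1}" if "i \<in> {1..n}" for i
      using PiE_mem[OF D that] by (auto simp: R_def)
    ultimately show "kap \<in> ?C" using k Weyl_ext[OF k] by (simp add: strip_def PiE_iff)
  qed
  then have "?rhs = (\<Sum>kap\<in>?D. \<Prod>i=1..n. Q powi (nu i - kap i) * c powi (k i - kap i))"
    by (simp add: prod.distrib)
  also have "\<dots> = (\<Prod>i=1..n. \<Sum>m\<in>R i. Q powi (nu i - m) * c powi (k i - m))"
    by (intro prod_sum_PiE[symmetric]) (auto simp: R_def)
  also have "\<dots> = (\<Prod>i=1..n. Q powi (nu i - k i)) *
        (\<Prod>i=1..n. of_bool (nu (Suc i) \<le> K i \<and> K i \<le> nu i)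
                       + x * of_bool (nu (Suc i) \<le> K i - 1 \<and> K i - 1 \<le> nu i))"
    unfolding prod.distrib[symmetric]
  proof (rule prod.cong[OF refl])
    fix i assume "i \<in> {1..n}"
    then have K: "K i = k i" by (auto simp: K_def)
    have "Q powi (nu i - (k i - 1)) = Q powi (nu i - k i) * Q"
      using power_int_add_1[of Q "nu i - k i"] Q by (simp add: algebra_simps)
    then show "(\<Sum>m\<in>R i. Q powi (nu i - m) * c powi (k i - m))
      = Q powi (nu i - k i) * (of_bool (nu (Suc i) \<le> K i \<and> K i \<le> nu i)
                       + x * of_bool (nu (Suc i) \<le> K i - 1 \<and> K i - 1 \<le> nu i))"
      unfolding R_def K by (subst sum_filtered_pair) (simp_all add: x_def algebra_simps)
  qed
  finally have rhs: "?rhs = (\<Prod>i=1..n. Q powi (nu i - k i)) *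
        (\<Prod>i=1..n. of_bool (nu (Suc i) \<le> K i \<and> K i \<le> nu i)
                       + x * of_bool (nu (Suc i) \<le> K i - 1 \<and> K i - 1 \<le> nu i))"
    (is "_ = ?P * ?R") .

  have KK: "K (Suc i) \<le> K i" if "i < n" for i
    using that Weyl_mono[OF k, of i "Suc i"] by (cases i) (auto simp: K_def)
  have pre: "(1 + x) * ?R = (\<Prod>i=1..n. of_bool (K i \<le> nu i \<and> nu i \<le> K (i - 1))
                       + x * of_bool (K i \<le> nu i + 1 \<and> nu i + 1 \<le> K (i - 1)))
      * (of_bool (nu (Suc n) \<le> K n) + x * of_bool (nu (Suc n) + 1 \<le> K n))"
    (is "_ = ?L * ?c")
    using KK Weyl_mono[OF nu] by (intro exchange_prefix[where n = n]) (auto simp: K_def)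
  have L': "L' = of_bool (nu (Suc n) \<le> K n \<and> nu (Suc n) = a) + c * of_bool (nu (Suc n) + 1 \<le> K n \<and> nu (Suc n) + 1 = a)"
    unfolding L'_def S'_def by (subst sum_filtered_pair) simp_all
  have g: "?g = Q powi (nu (Suc n) - a) * (of_bool (min (K n) (nu (Suc n)) = a)
      + c * Q * of_bool (min (K n) (nu (Suc n) + 1) = a))"
  proof (cases n)
    case 0
    then have "min (K n) (nu (Suc n)) = nu (Suc n)" "min (K n) (nu (Suc n) + 1) = nu (Suc n) + 1"
      by (auto simp: K_def)
    then show ?thesis using 0 by (simp add: Let_def)
  qed (simp add: K_def Let_def)
  have "?c * ?g = (1 + x) * L'"
    unfolding L' g x_def by (rule last_exchange[OF Q])
  then have "?g * ?c = L' * (1 + x)"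
    unfolding mult.commute[of ?g] mult.commute[of L'] .
  with pre have "(1 + x) * (?R * ?g) = (?L * L') * (1 + x)"
    by (rule mult_exchange)
  then have "?R * ?g = ?L * L'" using x by (simp add: mult.commute[of _ "1 + x"])
  then show ?thesis unfolding lhs rhs by (simp add: mult.assoc)
qed

text \<open>
  The positions from which \<open>y\<close> can be reached in one step. They need not be ordered: a pattern weight
  vanishes on left edges that are not, and a product set is easier to split.
\<close>

definition preds :: "nat \<Rightarrow> (nat \<Rightarrow> int) \<Rightarrow> (nat \<Rightarrow> int) set" where
  "preds n y = (\<Pi>\<^sub>E i\<in>{1..n}. {y i - 1, y i})"

lemma finite_preds [simp]: "finite (preds n y)"
  unfolding preds_def by (intro finite_PiE) auto

lemma sum_preds_Suc:
  "(\<Sum>z\<in>preds (Suc n) y. F z :: real) = (\<Sum>v\<in>{y (Suc n) - 1, y (Suc n)}. \<Sum>z\<in>preds n y. F (z(Suc n := v)))"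
proof -
  have "preds (Suc n) y = (\<lambda>(v, g). g(Suc n := v)) ` ({y (Suc n) - 1, y (Suc n)} \<times> preds n y)"
    unfolding preds_def atLeastAtMostSuc_conv[OF le_SucI, OF le_refl] PiE_insert_eq[symmetric]
    by (simp add: atLeastAtMostSuc_conv PiE_insert_eq)
  moreover have "inj_on (\<lambda>(v, g). g(Suc n := v)) ({y (Suc n) - 1, y (Suc n)} \<times> preds n y)"
    unfolding preds_def by (intro inj_combinator) auto
  ultimately have "(\<Sum>z\<in>preds (Suc n) y. F z)
      = (\<Sum>(v, g)\<in>{y (Suc n) - 1, y (Suc n)} \<times> preds n y. F (g(Suc n := v)))"
    by (simp add: sum.reindex case_prod_unfold)
  then show ?thesis by (simp only: sum.cartesian_product)
qed

text \<open>
  The matrix identity \<open>S A = A G\<close>. Both sides are expanded down to the row \<open>k\<close> below the new top row. On the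
  left this row is reached by first enlarging \<open>nu\<close> to \<open>lam\<close> and then going down, on the right by first
  going down to \<open>kap\<close> and then, by the induction hypothesis, enlarging \<open>kap\<close>. For a fixed row \<open>k\<close> the
  two are compared by \<open>dual_cauchy_one_step\<close>; the last entry of \<open>k\<close> is the new position of particle \<open>n\<close>.
\<close>

lemma intertwining:
  assumes "nu \<in> Weyl n" "c > 0" "\<And>i. 1 \<le> i \<Longrightarrow> i \<le> n \<Longrightarrow> q i > 0"
  shows "strip_op n c (\<lambda>lam. gt_weight q n lam y) nu
    = (\<Sum>x\<in>preds n y. gt_weight q n nu x * (\<Prod>k=1..n. step_factor c q x y k))"
  using assms
proof (induction n arbitrary: nu)
  case 0
  then show ?case by (simp add: strip_op_def preds_def strip_def Weyl_0)
next
  case (Suc n)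
  let ?Q = "q (Suc n)" and ?a = "y (Suc n)"
  have Q: "?Q > 0" using Suc.prems by simp
  let ?sw = "\<lambda>x. \<Prod>k=1..n. step_factor c q x y k"
  let ?wk = "\<lambda>kap. \<Prod>i=1..n. ?Q powi (nu i - kap i)"
  define g where "g = step_factor c q nu y (Suc n)"
  define X where "X = {lam \<in> strip (Suc n) 1 nu. lam (Suc n) = ?a}"
  define Y where "Y = (\<Union>lam\<in>X. interlacing n lam) \<union> (\<Union>kap\<in>interlacing n nu. strip n 1 kap)"
  have Y: "finite Y" by (auto simp: Y_def X_def)
  have YW: "k \<in> Weyl n" if "k \<in> Y" for k
    using that interlacing_Weyl strip_Weyl by (auto simp: Y_def)
  let ?wl = "\<lambda>lam k. (\<Prod>i=1..Suc n. c powi (lam i - nu i)) * (\<Prod>i=1..n. ?Q powi (lam i - k i))"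
  let ?wr = "\<lambda>kap k. ?wk kap * (\<Prod>i=1..n. c powi (k i - kap i))"

  have "strip_op (Suc n) c (\<lambda>lam. gt_weight q (Suc n) lam y) nu
      = (\<Sum>lam\<in>X. (\<Prod>i=1..Suc n. c powi (lam i - nu i)) *
          (\<Sum>k\<in>interlacing n lam. (\<Prod>i=1..n. ?Q powi (lam i - k i)) * gt_weight q n k y))"
    unfolding strip_op_def X_def by (rule sum.mono_neutral_cong_right) auto
  also have "\<dots> = (\<Sum>lam\<in>X. \<Sum>k\<in>interlacing n lam. ?wl lam k * gt_weight q n k y)"
    by (simp only: sum_distrib_left mult.assoc)
  also have "\<dots> = (\<Sum>k\<in>Y. \<Sum>lam\<in>{lam \<in> X. k \<in> interlacing n lam}. ?wl lam k * gt_weight q n k y)"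
    using Y by (intro sum_swap_dependent) (auto simp: Y_def X_def)
  also have "\<dots> = (\<Sum>k\<in>Y. \<Sum>kap\<in>{kap \<in> interlacing n nu. k \<in> strip n 1 kap}.
                      g * (?wr kap k * gt_weight q n k y))"
  proof (rule sum.cong[OF refl])
    fix k assume "k \<in> Y"
    show "(\<Sum>lam\<in>{lam \<in> X. k \<in> interlacing n lam}. ?wl lam k * gt_weight q n k y)
      = (\<Sum>kap\<in>{kap \<in> interlacing n nu. k \<in> strip n 1 kap}. g * (?wr kap k * gt_weight q n k y))"
    proof (cases "gt_weight q n k y = 0")
      case False
      have X': "{lam \<in> X. k \<in> interlacing n lam}
         = {lam \<in> strip (Suc n) 1 nu. lam (Suc n) = ?a \<and> k \<in> interlacing n lam}"
        by (auto simp: X_def)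
      have g': "(let f = (\<lambda>w. if n = 0 then nu (Suc n) + w else min (k n) (nu (Suc n) + w))
         in ?Q powi (nu (Suc n) - ?a) * (of_bool (f 0 = ?a) + c * ?Q * of_bool (f 1 = ?a))) = g"
        using gt_weight_last[OF False] by (cases "n = 0") (auto simp: g_def step_factor_def Let_def)
      have "(\<Sum>lam\<in>{lam \<in> X. k \<in> interlacing n lam}. ?wl lam k)
         = (\<Sum>kap\<in>{kap \<in> interlacing n nu. k \<in> strip n 1 kap}. ?wr kap k) * g"
        unfolding X' g'[symmetric]
        by (rule dual_cauchy_one_step[OF Suc.prems(1) YW[OF \<open>k \<in> Y\<close>] Suc.prems(2) Q])
      then show ?thesis
        unfolding sum_distrib_left[symmetric] sum_distrib_right[symmetric] by simp
    qed simp
  qed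
  also have "\<dots> = (\<Sum>kap\<in>interlacing n nu. \<Sum>k\<in>strip n 1 kap. g * (?wr kap k * gt_weight q n k y))"
    using Y by (intro sum_swap_dependent) (auto simp: Y_def)
  also have "\<dots> = (\<Sum>kap\<in>interlacing n nu. g * (?wk kap * strip_op n c (\<lambda>lam. gt_weight q n lam y) kap))"
    unfolding strip_op_def by (simp only: sum_distrib_left mult.assoc)
  also have "\<dots> = (\<Sum>kap\<in>interlacing n nu. g * (?wk kap * (\<Sum>x\<in>preds n y. gt_weight q n kap x * ?sw x)))"
    using Suc.IH[OF interlacing_Weyl Suc.prems(2)] Suc.prems(3) by (intro sum.cong) auto
  also have "\<dots> = g * (\<Sum>x\<in>preds n y. (\<Sum>kap\<in>interlacing n nu. ?wk kap * gt_weight q n kap x) * ?sw x)"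
    unfolding sum_distrib_left sum_distrib_right
    by (subst sum.swap) (simp only: mult_ac)
  finally have lhs: "strip_op (Suc n) c (\<lambda>lam. gt_weight q (Suc n) lam y) nu
    = g * (\<Sum>x\<in>preds n y. (\<Sum>kap\<in>interlacing n nu. ?wk kap * gt_weight q n kap x) * ?sw x)" .

  (* The position of the last particle before the step is the last entry of nu; only one of the two
     values of v can contribute. *)
  have upd: "gt_weight q (Suc n) nu (x(Suc n := v)) * (\<Prod>k=1..Suc n. step_factor c q (x(Suc n := v)) y k)
      = of_bool (nu (Suc n) = v) * (g * ((\<Sum>kap\<in>interlacing n nu. ?wk kap * gt_weight q n kap x) * ?sw x))"
    (is "_ * ?p = _") for x v
  proof -
    have "(\<Prod>k=1..n. step_factor c q (x(Suc n := v)) y k) = ?sw x"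
      by (intro prod.cong refl step_factor_cong) simp
    then have p: "?p = ?sw x * step_factor c q (x(Suc n := v)) y (Suc n)"
      by (simp only: prod_1_Suc)
    have sf: "step_factor c q (x(Suc n := v)) y (Suc n) = g" if "nu (Suc n) = v"
      unfolding g_def using that by (intro step_factor_cong) simp
    have gw: "gt_weight q n kap (x(Suc n := v)) = gt_weight q n kap x" for kap
      by (rule gt_weight_cong) simp
    show ?thesis
    proof (cases "nu (Suc n) = v")
      case True
      show ?thesis unfolding p sf[OF True] using True by (simp add: gw)
    qed simp
  qed
  have zero: "g * (\<Sum>x\<in>preds n y. (\<Sum>kap\<in>interlacing n nu. ?wk kap * gt_weight q n kap x) * ?sw x) = 0"
    if "nu (Suc n) \<notin> {?a - 1, ?a}"
  proof -
    have "strip_op (Suc n) c (\<lambda>lam. gt_weight q (Suc n) lam y) nu = 0"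
      unfolding strip_op_def
    proof (rule sum.neutral, rule ballI)
      fix lam assume "lam \<in> strip (Suc n) 1 nu"
      then have "lam (Suc n) \<noteq> ?a" using strip_cases[of lam "Suc n" 1 nu "Suc n"] that by auto
      then show "(\<Prod>i=1..Suc n. c powi (lam i - nu i)) * gt_weight q (Suc n) lam y = 0" by simp
    qed
    with lhs show ?thesis by simp
  qed
  have "(\<Sum>x\<in>preds (Suc n) y. gt_weight q (Suc n) nu x * (\<Prod>k=1..Suc n. step_factor c q x y k))
    = (\<Sum>v\<in>{?a - 1, ?a}. of_bool (nu (Suc n) = v) *
        (g * (\<Sum>x\<in>preds n y. (\<Sum>kap\<in>interlacing n nu. ?wk kap * gt_weight q n kap x) * ?sw x)))"
    unfolding sum_preds_Suc upd by (simp only: sum_distrib_left)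
  also have "\<dots> = g * (\<Sum>x\<in>preds n y. (\<Sum>kap\<in>interlacing n nu. ?wk kap * gt_weight q n kap x) * ?sw x)"
  proof -
    have pair: "(\<Sum>v\<in>{a - 1, a}. of_bool (u = v) * E) = of_bool (u \<in> {a - 1, a}) * E"
      for a u :: int and E :: real by auto
    show ?thesis unfolding pair using zero by (cases "nu (Suc n) \<in> {?a - 1, ?a}") (simp_all only: of_bool_eq mult_1 mult_zero_left if_True if_False simp_thms)
  qed
  finally show ?case using lhs by simp
qed

section \<open>The transition probabilities\<close>

lemma prob_pair_pmf_times:
  "measure_pmf.prob (pair_pmf M N) (A \<times> B) = measure_pmf.prob M A * measure_pmf.prob N B"
proof -
  have "measure_pmf.prob (pair_pmf M N) (A \<times> B)
      = measure_pmf.prob (pair_pmf M N) ((A \<inter> set_pmf M) \<times> (B \<inter> set_pmf N))"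
    by (subst measure_Int_set_pmf[symmetric], rule arg_cong[where f = "measure_pmf.prob _"]) auto
  also have "\<dots> = measure_pmf.prob M (A \<inter> set_pmf M) * measure_pmf.prob N (B \<inter> set_pmf N)"
    by (rule measure_pmf_prob_product) auto
  finally show ?thesis by (simp add: measure_Int_set_pmf)
qed

lemma prob_bernoulli:
  assumes "0 \<le> c" "c \<le> 1"
  shows "measure_pmf.prob (bernoulli_pmf c) S = of_bool (False \<in> S) * (1 - c) + of_bool (True \<in> S) * c"
proof -
  have "measure_pmf.prob (bernoulli_pmf c) S = (\<Sum>b\<in>S. pmf (bernoulli_pmf c) b)"
    by (rule measure_measure_pmf_finite) simp
  also have "\<dots> = (\<Sum>b\<in>UNIV. if b \<in> S then pmf (bernoulli_pmf c) b else 0)"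
    by (simp add: sum.If_cases)
  finally show ?thesis using assms by (simp add: UNIV_bool)
qed

lemma dtasep_step_cong:
  assumes "\<And>j. 1 \<le> j \<Longrightarrow> j \<le> k \<Longrightarrow> W j = V j \<and> X j = Y j" "1 \<le> k"
  shows "dtasep_step W X k = dtasep_step V Y k"
  using assms by (induction W X k rule: dtasep_step.induct) auto

lemma dtasep_cong:
  assumes "\<And>s k. r < s \<Longrightarrow> s \<le> r + m \<Longrightarrow> 1 \<le> k \<Longrightarrow> k \<le> N \<Longrightarrow> W (s, k) = V (s, k)"
    and "1 \<le> k" "k \<le> N"
  shows "dtasep W r a m k = dtasep V r a m k"
  using assms
proof (induction m arbitrary: k)
  case (Suc m)
  show ?case unfolding dtasep.simps
    by (rule dtasep_step_cong) (use Suc in auto)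
qed simp

lemma dtasep_step_bounds:
  assumes "\<And>i. 1 \<le> i \<Longrightarrow> i < N \<Longrightarrow> Y (Suc i) < Y i" "1 \<le> k" "k \<le> N"
  shows "Y k \<le> dtasep_step W Y k \<and> dtasep_step W Y k \<le> Y k + 1"
  using assms(2,3)
proof (induction k rule: nat_induct_at_least)
  case (Suc k)
  then obtain j where j: "k = Suc j" by (cases k) auto
  show ?case using Suc.IH Suc.prems assms(1)[of k] by (auto simp: j)
qed (simp add: of_bool_def)

lemma dtasep_step_strict: "1 \<le> i \<Longrightarrow> dtasep_step W Y (Suc i) < dtasep_step W Y i"
  by (cases i) auto

lemma dtasep_strict:
  assumes "\<And>i. 1 \<le> i \<Longrightarrow> i < N \<Longrightarrow> a (Suc i) < a i" "1 \<le> i" "i < N"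
  shows "dtasep W r a m (Suc i) < dtasep W r a m i"
  using assms by (cases m) (auto simp: dtasep_step_strict)

text \<open>
  Given the new position of particle \<open>k - 1\<close>, the outcomes of the jump variable of particle \<open>k\<close> that take
  it from \<open>x k\<close> to \<open>y k\<close>, in coordinates in which particle \<open>k\<close> sits at \<open>x k - k\<close>.
\<close>

definition allowed_jumps :: "(nat \<Rightarrow> int) \<Rightarrow> (nat \<Rightarrow> int) \<Rightarrow> nat \<Rightarrow> bool set" where
  "allowed_jumps x y k = {w. (if k = 1 then x k + of_bool w else min (y (k - 1)) (x k + of_bool w)) = y k}"

text \<open>
  Although the update is sequential, prescribing all new positions amounts to a separate condition on each
  jump variable, so that the probability of a transition is a product.
\<close>

lemma dtasep_step_iff:
  assumes "\<And>k. 1 \<le> k \<Longrightarrow> k \<le> N \<Longrightarrow> Y k = x k - int k"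
  shows "(\<forall>k\<in>{1..N}. dtasep_step W Y k = y k - int k) \<longleftrightarrow> (\<forall>k\<in>{1..N}. W k \<in> allowed_jumps x y k)"
proof -
  have step: "dtasep_step W Y k = y k - int k \<longleftrightarrow> W k \<in> allowed_jumps x y k"
    if "1 \<le> k" "k \<le> N" "1 < k \<Longrightarrow> dtasep_step W Y (k - 1) = y (k - 1) - int (k - 1)" for k
  proof (cases "k = 1")
    case True
    then show ?thesis using that assms[of 1] by (auto simp: allowed_jumps_def)
  next
    case False
    then have "k = Suc (Suc (k - 2))" using that(1) by arith
    then obtain j where j: "k = Suc (Suc j)" by blast
    then show ?thesis using that assms[of k] by (auto simp: allowed_jumps_def min_def)
  qed
  show ?thesis
  proof
    assume *: "\<forall>k\<in>{1..N}. dtasep_step W Y k = y k - int k"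
    show "\<forall>k\<in>{1..N}. W k \<in> allowed_jumps x y k"
    proof
      fix k assume k: "k \<in> {1..N}"
      have "dtasep_step W Y (k - 1) = y (k - 1) - int (k - 1)" if "1 < k"
      proof -
        have "k - 1 \<in> {1..N}" using that k by auto
        then show ?thesis using * by blast
      qed
      then show "W k \<in> allowed_jumps x y k" using step[of k] * k by auto
    qed
  next
    assume W: "\<forall>k\<in>{1..N}. W k \<in> allowed_jumps x y k"
    have "dtasep_step W Y k = y k - int k" if "1 \<le> k" "k \<le> N" for k
      using that
    proof (induction k rule: nat_induct_at_least)
      case base
      then show ?case using W step[of 1] by auto
    next
      case (Suc k)
      then show ?case using W step[of "Suc k"] by auto
    qed
    then show "\<forall>k\<in>{1..N}. dtasep_step W Y k = y k - int k" by auto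
  qed
qed

lemma prob_allowed_jumps:
  assumes "c > 0" "q k > 0"
  shows "measure_pmf.prob (bernoulli_pmf (c * q k / (1 + c * q k))) (allowed_jumps x y k)
    = q k powi (y k - x k) * (step_factor c q x y k / (1 + c * q k))"
proof -
  have pos: "c * q k > 0" using assms by simp
  then have "0 \<le> c * q k / (1 + c * q k)" "c * q k / (1 + c * q k) \<le> 1" by (simp_all add: field_simps)
  note prob = prob_bernoulli[OF this]
  define f where "f w = (if k = 1 then x k + w else min (y (k - 1)) (x k + w))" for w
  have "q k powi (y k - x k) * q k powi (x k - y k) = 1"
    using assms by (simp flip: power_int_add)
  then have "q k powi (y k - x k) * step_factor c q x y k
      = of_bool (f 0 = y k) + c * q k * of_bool (f 1 = y k)"
    unfolding step_factor_def f_def Let_def by (simp only: mult.assoc[symmetric] mult_1)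
  moreover have "1 - c * q k / (1 + c * q k) = 1 / (1 + c * q k)"
    using pos by (simp add: field_simps)
  ultimately show ?thesis unfolding prob
    by (simp add: allowed_jumps_def f_def add_divide_distrib)
qed

text \<open>
  The Markov property. The jump variables up to time \<open>r + m\<close> are independent of those at time
  \<open>r + m + 1\<close>. As the particles stay strictly ordered, the exclusion rule never pushes a particle back, so every
  particle moves by \<open>0\<close> or \<open>1\<close> and the configuration before the last step belongs to \<open>preds N y'\<close>.
\<close>

lemma dtasep_prob_Suc:
  assumes y: "y \<in> Weyl N" and p: "p (Suc (r + m)) > 0" and q: "\<And>i. 1 \<le> i \<Longrightarrow> i \<le> N \<Longrightarrow> q i > 0"
  shows "dtasep_prob N p q r (r + Suc m) y y' = (\<Sum>x\<in>preds N y'. dtasep_prob N p q r (r + m) y x *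
    (\<Prod>k=1..N. q k powi (y' k - x k) * (step_factor (p (Suc (r + m))) q x y' k / (1 + p (Suc (r + m)) * q k))))"
proof -
  define A where "A = {r<..r + m} \<times> {1..N}"
  define B where "B = {Suc (r + m)} \<times> {1..N}"
  define bern where "bern = (\<lambda>(s, k). bernoulli_pmf (p s * q k / (1 + p s * q k)))"
  define a where "a = (\<lambda>i. y i - int i)"
  define E where "E x = {W. \<forall>k\<in>{1..N}. dtasep W r a m k = x k - int k}" for x
  define F where "F x = {W. \<forall>k\<in>{1..N}. W (Suc (r + m), k) \<in> allowed_jumps x y' k}" for x
  let ?h = "\<lambda>(f, g) x. if x \<in> A then f x else g x"
  let ?P = "pair_pmf (Pi_pmf A False bern) (Pi_pmf B False bern)"
  have fin: "finite A" "finite B" and dis: "A \<inter> B = {}" by (auto simp: A_def B_def)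
  have "{r<..r + Suc m} \<times> {1..N} = A \<union> B" by (auto simp: A_def B_def)
  then have jump: "jump_pmf N p q r (r + Suc m) = map_pmf ?h ?P"
    unfolding jump_pmf_def by (simp only: Pi_pmf_union[OF fin dis] bern_def)
  have a: "a (Suc i) < a i" if "1 \<le> i" "i < N" for i
    using that Weyl_mono[OF y, of i "Suc i"] by (simp add: a_def)
  have vim: "?h -` {W. \<forall>k\<in>{1..N}. dtasep W r a (Suc m) k = y' k - int k} = (\<Union>x\<in>preds N y'. E x \<times> F x)"
    (is "?L = ?R")
  proof -
    have 1: "(\<forall>k\<in>{1..N}. dtasep (?h (f, g)) r a (Suc m) k = y' k - int k) \<longleftrightarrow> g \<in> F x"
      if "f \<in> E x" for f g x
    proof -
      have "dtasep (?h (f, g)) r a m k = x k - int k" if "1 \<le> k" "k \<le> N" for k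
      proof -
        have "dtasep (?h (f, g)) r a m k = dtasep f r a m k"
          by (rule dtasep_cong[where N = N]) (use that in \<open>auto simp: A_def\<close>)
        then show ?thesis using \<open>f \<in> E x\<close> that by (auto simp: E_def)
      qed
      from dtasep_step_iff[where N = N, OF this]
      show ?thesis by (simp add: F_def A_def)
    qed
    show ?thesis
    proof (intro equalityI subsetI)
      fix fg assume "fg \<in> ?L"
      obtain f g where fg: "fg = (f, g)" by fastforce
      have L: "\<forall>k\<in>{1..N}. dtasep (?h (f, g)) r a (Suc m) k = y' k - int k"
        using \<open>fg \<in> ?L\<close> unfolding fg by (simp only: vimage_eq mem_Collect_eq)
      define x where "x = (\<lambda>k\<in>{1..N}. dtasep f r a m k + int k)"
      have fE: "f \<in> E x" by (auto simp: E_def x_def)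
      have "x k \<in> {y' k - 1, y' k}" if k: "k \<in> {1..N}" for k
      proof -
        have eq: "dtasep (?h (f, g)) r a m k = dtasep f r a m k"
          by (rule dtasep_cong[where N = N]) (use k in \<open>auto simp: A_def\<close>)
        have "dtasep (?h (f, g)) r a m k \<le> dtasep (?h (f, g)) r a (Suc m) k
            \<and> dtasep (?h (f, g)) r a (Suc m) k \<le> dtasep (?h (f, g)) r a m k + 1"
          unfolding dtasep.simps
          by (rule dtasep_step_bounds[where N = N]) (use k dtasep_strict[of N a, OF a] in auto)
        then show ?thesis using L k eq by (auto simp: x_def)
      qed
      then have "x \<in> preds N y'" by (auto simp: preds_def x_def PiE_iff)
      then show "fg \<in> ?R" using 1[OF fE] L fE fg by auto
    next
      fix fg assume "fg \<in> ?R"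
      then obtain f g x where fg: "fg = (f, g)" and "f \<in> E x" "g \<in> F x" by auto
      then show "fg \<in> ?L" unfolding fg vimage_eq mem_Collect_eq using 1[of f x g] by blast
    qed
  qed
  have disj: "disjoint_family_on (\<lambda>x. E x \<times> F x) (preds N y')"
    unfolding disjoint_family_on_def
  proof (intro ballI impI)
    fix x z assume xz: "x \<in> preds N y'" "z \<in> preds N y'" "x \<noteq> z"
    have "x = z" if "f \<in> E x" "f \<in> E z" for f
    proof (rule extensionalityI[where A = "{1..N}"])
      show "x \<in> extensional {1..N}" "z \<in> extensional {1..N}" using xz by (auto simp: preds_def PiE_iff)
      fix k assume "k \<in> {1..N}"
      then show "x k = z k" using that by (auto simp: E_def)
    qed
    then show "(E x \<times> F x) \<inter> (E z \<times> F z) = {}" using xz(3) by auto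
  qed
  have PF: "measure_pmf.prob (Pi_pmf B False bern) (F x)
      = (\<Prod>k=1..N. q k powi (y' k - x k) * (step_factor (p (Suc (r + m))) q x y' k / (1 + p (Suc (r + m)) * q k)))" for x
  proof -
    have "F x = Pi B (\<lambda>(s, k). allowed_jumps x y' k)" by (auto simp: F_def B_def Pi_def)
    then have "measure_pmf.prob (Pi_pmf B False bern) (F x)
        = (\<Prod>(s, k)\<in>B. measure_pmf.prob (bernoulli_pmf (p s * q k / (1 + p s * q k))) (allowed_jumps x y' k))"
      by (simp add: measure_Pi_pmf_Pi[OF fin(2)] bern_def case_prod_unfold)
    also have "\<dots> = (\<Prod>k=1..N. measure_pmf.prob (bernoulli_pmf (p (Suc (r + m)) * q k / (1 + p (Suc (r + m)) * q k))) (allowed_jumps x y' k))"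
      unfolding B_def by (subst prod.cartesian_product[symmetric]) simp
    also have "\<dots> = (\<Prod>k=1..N. q k powi (y' k - x k) * (step_factor (p (Suc (r + m))) q x y' k / (1 + p (Suc (r + m)) * q k)))"
      by (intro prod.cong refl prob_allowed_jumps) (use p q in auto)
    finally show ?thesis .
  qed
  have PE: "measure_pmf.prob (Pi_pmf A False bern) (E x) = dtasep_prob N p q r (r + m) y x" for x
    by (simp add: dtasep_prob_def jump_pmf_def A_def bern_def E_def a_def)
  have "dtasep_prob N p q r (r + Suc m) y y' = measure_pmf.prob ?P (\<Union>x\<in>preds N y'. E x \<times> F x)"
    unfolding dtasep_prob_def jump measure_map_pmf vim[symmetric] a_def by simp
  also have "\<dots> = (\<Sum>x\<in>preds N y'. measure_pmf.prob ?P (E x \<times> F x))"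
    by (rule measure_pmf.finite_measure_finite_Union) (use disj in auto)
  also have "\<dots> = (\<Sum>x\<in>preds N y'. dtasep_prob N p q r (r + m) y x *
    (\<Prod>k=1..N. q k powi (y' k - x k) * (step_factor (p (Suc (r + m))) q x y' k / (1 + p (Suc (r + m)) * q k))))"
    by (simp only: prob_pair_pmf_times PE PF)
  finally show ?thesis .
qed

lemma Zconst_Suc: "Zconst N p q r (r + Suc m) = Zconst N p q r (r + m) * (\<Prod>j=1..N. 1 + p (Suc (r + m)) * q j)"
  by (simp add: Zconst_def)

text \<open>
  Transition probabilities as \<open>q^(y' - y) / Z * B S A\<close>. The induction step adds the last time step: by
  linearity its transition matrix acts on the patterns alone, where it becomes a strip matrix.
\<close>

theorem dtasep_prob_eq_operators:
  assumes y: "y \<in> Weyl N" and p: "\<And>i. i \<ge> 1 \<Longrightarrow> p i > 0" and q: "\<And>i. 1 \<le> i \<Longrightarrow> i \<le> N \<Longrightarrow> q i > 0"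
  shows "dtasep_prob N p q r (r + m) y y' = (\<Prod>i=1..N. q i powi (y' i - y i)) / Zconst N p q r (r + m) *
     inverse_op q N y (strips_op p r N m (\<lambda>lam. gt_weight q N lam y'))"
proof (induction m arbitrary: y')
  case 0
  have 1: "dtasep_prob N p q r r y y' = of_bool (\<forall>k\<in>{1..N}. y k = y' k)"
    by (auto simp: dtasep_prob_def)
  have 2: "(\<Prod>i=1..N. q i powi (y' i - y i)) = 1" if "\<forall>k\<in>{1..N}. y k = y' k"
    using that by (intro prod.neutral) auto
  have 3: "inverse_op q N y (\<lambda>lam. gt_weight q N lam y') = of_bool (\<forall>k\<in>{1..N}. y k = y' k)"
    by (rule inverse_op_gt_weight[OF y q])
  show ?case
  proof (cases "\<forall>k\<in>{1..N}. y k = y' k")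
    case True
    show ?thesis unfolding add_0_right strips_op.simps 1 2[OF True] 3 by (simp add: Zconst_def)
  next
    case False
    show ?thesis unfolding add_0_right strips_op.simps 1 3 of_bool_def if_not_P[OF False] by simp
  qed
next
  case (Suc m)
  let ?c = "p (Suc (r + m))"
  let ?sw = "\<lambda>x. \<Prod>k=1..N. step_factor ?c q x y' k"
  let ?Z = "\<Prod>k=1..N. 1 + ?c * q k"
  let ?G = "\<lambda>x lam. gt_weight q N lam x"
  let ?M = "\<lambda>x. inverse_op q N y (strips_op p r N m (?G x))"
  let ?qq = "\<Prod>i=1..N. q i powi (y' i - y i)"
  have c: "?c > 0" using p by simp
  have summand: "(\<Prod>i=1..N. q i powi (x i - y i)) / Zconst N p q r (r + m) * ?M x *
      (\<Prod>k=1..N. q k powi (y' k - x k) * (step_factor ?c q x y' k / (1 + ?c * q k)))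
     = ?qq / Zconst N p q r (r + Suc m) * (?sw x * ?M x)" for x
  proof -
    have "(\<Prod>i=1..N. q i powi (x i - y i)) * (\<Prod>i=1..N. q i powi (y' i - x i)) = ?qq"
      unfolding prod.distrib[symmetric]
    proof (rule prod.cong[OF refl])
      fix i assume "i \<in> {1..N}"
      then have "q i \<noteq> 0" using q[of i] by auto
      then show "q i powi (x i - y i) * q i powi (y' i - x i) = q i powi (y' i - y i)"
        by (simp flip: power_int_add)
    qed
    then show ?thesis unfolding Zconst_Suc prod.distrib prod_dividef by (simp add: field_simps)
  qed
  have "dtasep_prob N p q r (r + Suc m) y y'
     = (\<Sum>x\<in>preds N y'. ?qq / Zconst N p q r (r + Suc m) * (?sw x * ?M x))"
    unfolding summand[symmetric] Suc.IH[symmetric] by (intro dtasep_prob_Suc[where p = p and r = r and m = m] y c q)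
  also have "\<dots> = ?qq / Zconst N p q r (r + Suc m) * (\<Sum>x\<in>preds N y'. ?sw x * ?M x)"
    by (simp only: sum_distrib_left)
  also have "(\<Sum>x\<in>preds N y'. ?sw x * ?M x)
     = inverse_op q N y (\<lambda>mu. \<Sum>x\<in>preds N y'. ?sw x * strips_op p r N m (?G x) mu)"
    by (rule inverse_op_linear[symmetric])
  also have "\<dots> = inverse_op q N y (strips_op p r N (Suc m) (\<lambda>lam. gt_weight q N lam y'))"
  proof (rule inverse_op_cong)
    fix mu assume mu: "mu \<in> Weyl N"
    have "(\<Sum>x\<in>preds N y'. ?sw x * strips_op p r N m (?G x) mu)
        = strips_op p r N m (\<lambda>lam. \<Sum>x\<in>preds N y'. ?sw x * ?G x lam) mu"
      by (rule strips_op_linear[OF mu, symmetric])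
    also have "\<dots> = strips_op p r N m (strip_op N ?c (\<lambda>lam. gt_weight q N lam y')) mu"
    proof (rule strips_op_cong[OF mu])
      fix lam assume "lam \<in> Weyl N"
      then show "(\<Sum>x\<in>preds N y'. ?sw x * ?G x lam) = strip_op N ?c (\<lambda>lam. gt_weight q N lam y') lam"
        using intertwining[of lam N ?c q y'] p q by (simp add: mult.commute)
    qed
    finally show "(\<Sum>x\<in>preds N y'. ?sw x * strips_op p r N m (?G x) mu)
       = strips_op p r N (Suc m) (\<lambda>lam. gt_weight q N lam y') mu" by simp
  qed
  finally show ?case .
qed

section \<open>Path ensembles and their concatenation\<close>

lemma is_path_Nil [simp]: "\<not> is_path step a b []"
  by (simp add: is_path_def)

lemma is_path_Cons:
  "is_path step a b (u # \<pi>) \<longleftrightarrow> u = a \<and> (if \<pi> = [] then a = b else step a (hd \<pi>) \<and> is_path step (hd \<pi>) b \<pi>)"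
  by (auto simp: is_path_def successively_Cons)

text \<open>
  A rank that increases by one along every step determines the length of a path from its endpoints,
  which makes ensembles finite and the decomposition of concatenated paths unique.
\<close>

definition graded :: "(vertex \<Rightarrow> vertex \<Rightarrow> bool) \<Rightarrow> (vertex \<Rightarrow> int) \<Rightarrow> bool" where
  "graded step rk \<longleftrightarrow> (\<forall>u v. step u v \<longrightarrow> rk v = rk u + 1) \<and> (\<forall>u. finite {v. step u v})"

lemma graded_step: "graded step rk \<Longrightarrow> step u v \<Longrightarrow> rk v = rk u + 1"
  and graded_finite: "graded step rk \<Longrightarrow> finite {v. step u v}"
  unfolding graded_def by blast+

lemma graded_length:
  assumes "graded step rk" shows "is_path step a b \<pi> \<Longrightarrow> int (length \<pi>) = rk b - rk a + 1"
proof (induction \<pi> arbitrary: a)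
  case (Cons u \<pi>)
  then show ?case using graded_step[OF assms, of a "hd \<pi>"] Cons.IH[of "hd \<pi>"]
    by (cases "\<pi> = []") (simp_all add: is_path_Cons)
qed simp

lemma graded_rank:
  assumes "graded step rk" shows "is_path step a b \<pi> \<Longrightarrow> v \<in> set \<pi> \<Longrightarrow> v = a \<or> rk a < rk v"
proof (induction \<pi> arbitrary: a)
  case (Cons u \<pi>)
  show ?case
  proof (cases "\<pi> = [] \<or> v = u")
    case False
    then have "step a (hd \<pi>)" "is_path step (hd \<pi>) b \<pi>" "v \<in> set \<pi>" using Cons.prems by (auto simp: is_path_Cons)
    moreover from this have "rk (hd \<pi>) = rk a + 1" by (intro graded_step[OF assms])
    ultimately show ?thesis using Cons.IH by fastforce
  qed (use Cons.prems in \<open>auto simp: is_path_Cons\<close>)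
qed simp

lemma graded_trivial:
  assumes "graded step rk" "rk a = rk b" shows "is_path step a b \<pi> \<longleftrightarrow> \<pi> = [a] \<and> a = b"
proof
  assume p: "is_path step a b \<pi>"
  then have "length \<pi> = 1" using graded_length[OF assms(1) p] assms(2) by simp
  then show "\<pi> = [a] \<and> a = b" using p by (cases \<pi>) (auto simp: is_path_Cons)
qed (auto simp: is_path_Cons)

lemma finite_paths:
  assumes "graded step rk" shows "finite {\<pi>. is_path step a b \<pi>}"
proof -
  have fin: "finite {\<pi>. is_path step a b \<pi> \<and> length \<pi> = n}" for n
  proof (induction n arbitrary: a)
    case (Suc n)
    have "{\<pi>. is_path step a b \<pi> \<and> length \<pi> = Suc n}
      \<subseteq> {[a]} \<union> (\<Union>v\<in>{v. step a v}. (#) a ` {\<pi>. is_path step v b \<pi> \<and> length \<pi> = n})"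
    proof
      fix \<pi> assume "\<pi> \<in> {\<pi>. is_path step a b \<pi> \<and> length \<pi> = Suc n}"
      then show "\<pi> \<in> {[a]} \<union> (\<Union>v\<in>{v. step a v}. (#) a ` {\<pi>. is_path step v b \<pi> \<and> length \<pi> = n})"
        by (cases \<pi>) (auto simp: is_path_Cons simp del: split_paired_Ex split: if_splits)
    qed
    moreover have "finite {v. step a v}" by (rule graded_finite[OF assms])
    ultimately show ?case using Suc by (auto intro: finite_subset)
  qed auto
  show ?thesis
    by (rule finite_subset[OF _ fin[of "nat (rk b - rk a + 1)"]]) (auto dest: graded_length[OF assms])
qed

lemma finite_path_ensemble:
  assumes "graded step rk" shows "finite (path_ensemble step n A B)"
proof (rule finite_subset)
  show "path_ensemble step n A B \<subseteq> (\<Pi>\<^sub>E k\<in>{1..n}. {\<pi>. is_path step (A k) (B k) \<pi>})"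
    by (auto simp: path_ensemble_def PiE_def Pi_def)
qed (intro finite_PiE finite_paths[OF assms] finite_atLeastAtMost)

lemma path_ensemble_iff:
  "\<pi> \<in> path_ensemble step n A B \<longleftrightarrow> \<pi> \<in> extensional {1..n} \<and>
     (\<forall>k\<in>{1..n}. is_path step (A k) (B k) (\<pi> k)) \<and>
     (\<forall>j\<in>{1..n}. \<forall>k\<in>{1..n}. j \<noteq> k \<longrightarrow> set (\<pi> j) \<inter> set (\<pi> k) = {})"
  by (auto simp: path_ensemble_def PiE_iff disjoint_family_on_def)

lemma path_ensemble_cong:
  assumes "\<And>k. k \<in> {1..n} \<Longrightarrow> A k = A' k \<and> B k = B' k"
  shows "path_ensemble step n A B = path_ensemble step n A' B'"
  using assms by (auto simp: path_ensemble_iff)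

lemma path_weight_simps [simp]:
  "path_weight w [] = 1" "path_weight w [u] = 1"
  "path_weight w (u # v # \<pi>) = w u v * path_weight w (v # \<pi>)"
  by (simp_all add: path_weight_def)

lemma path_weight_append:
  "\<pi> \<noteq> [] \<Longrightarrow> \<pi>' \<noteq> [] \<Longrightarrow> path_weight w (\<pi> @ \<pi>') = path_weight w \<pi> * w (last \<pi>) (hd \<pi>') * path_weight w \<pi>'"
proof (induction \<pi> rule: induct_list012)
  case (2 u)
  then show ?case by (cases \<pi>') auto
qed auto

text \<open>
  Dropping the first vertex of the second path does not lose an edge, since it is the last vertex of the
  first path.
\<close>

lemma path_weight_glue:
  assumes "\<pi> \<noteq> []" "\<pi>' \<noteq> []" "last \<pi> = hd \<pi>'"
  shows "path_weight w (\<pi> @ tl \<pi>') = path_weight w \<pi> * path_weight w \<pi>'"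
proof (cases "tl \<pi>' = []")
  case True
  then show ?thesis using assms by (cases \<pi>') auto
next
  case False
  then obtain u v \<rho> where "\<pi>' = u # v # \<rho>" using assms(2) by (metis list.collapse)
  then show ?thesis using assms by (simp add: path_weight_append)
qed

text \<open>
  What the multiplicativity of the weight needs: fixed endpoints, and path lengths that are the same for
  all tuples. Unlike the property of being an ensemble of non-intersecting paths, this is inherited by
  concatenations.
\<close>

definition framed :: "nat \<Rightarrow> (nat \<Rightarrow> vertex) \<Rightarrow> (nat \<Rightarrow> vertex) \<Rightarrow> (nat \<Rightarrow> vertex list) set \<Rightarrow> bool" where
  "framed n A B \<Sigma> \<longleftrightarrow> (\<forall>\<pi>\<in>\<Sigma>. \<pi> \<in> extensional {1..n} \<and>
       (\<forall>k\<in>{1..n}. \<pi> k \<noteq> [] \<and> hd (\<pi> k) = A k \<and> last (\<pi> k) = B k)) \<and>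
     (\<exists>l. \<forall>\<pi>\<in>\<Sigma>. \<forall>k\<in>{1..n}. length (\<pi> k) = l k)"

lemma framed_path_ensemble:
  assumes "graded step rk" "\<Sigma> \<subseteq> path_ensemble step n A B" shows "framed n A B \<Sigma>"
proof -
  have "length (\<pi> k) = nat (rk (B k) - rk (A k) + 1)" if "\<pi> \<in> \<Sigma>" "k \<in> {1..n}" for \<pi> k
  proof -
    have "is_path step (A k) (B k) (\<pi> k)" using that assms(2) by (auto simp: path_ensemble_iff)
    from graded_length[OF assms(1) this] show ?thesis by simp
  qed
  then have "\<exists>l. \<forall>\<pi>\<in>\<Sigma>. \<forall>k\<in>{1..n}. length (\<pi> k) = l k"
    by (intro exI[of _ "\<lambda>k. nat (rk (B k) - rk (A k) + 1)"]) simp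
  moreover have "\<pi> \<in> extensional {1..n} \<and> (\<forall>k\<in>{1..n}. \<pi> k \<noteq> [] \<and> hd (\<pi> k) = A k \<and> last (\<pi> k) = B k)"
    if "\<pi> \<in> \<Sigma>" for \<pi>
    using that assms(2) by (auto simp: path_ensemble_iff is_path_def)
  ultimately show ?thesis by (simp add: framed_def)
qed

lemma image_pairs: "{f a b | a b. a \<in> S \<and> b \<in> T} = (\<lambda>(a, b). f a b) ` (S \<times> T)"
  by auto

lemma concat_ensembles_image:
  "\<Sigma> \<squnion>\<^bsub>n\<^esub> \<Sigma>' = (\<lambda>(\<pi>, \<pi>'). \<lambda>j\<in>{1..n}. \<pi> j @ tl (\<pi>' j)) ` (\<Sigma> \<times> \<Sigma>')"
  unfolding concat_ensembles_def by (rule image_pairs)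

text \<open>
  Since the lengths of the first paths are fixed, gluing is injective, and the sum over the
  concatenation is a product of sums.
\<close>

lemma
  assumes "framed n A B \<Sigma>" "framed n B C \<Sigma>'"
  shows framed_concat: "framed n A C (\<Sigma> \<squnion>\<^bsub>n\<^esub> \<Sigma>')"
    and wt_concat: "wt n w (\<Sigma> \<squnion>\<^bsub>n\<^esub> \<Sigma>') = wt n w \<Sigma> * wt n w \<Sigma>'"
proof -
  note fr = assms[unfolded framed_def]
  obtain l where l: "\<forall>\<pi>\<in>\<Sigma>. \<forall>k\<in>{1..n}. length (\<pi> k) = l k" using conjunct2[OF fr(1)] ..
  obtain l' where l': "\<forall>\<pi>\<in>\<Sigma>'. \<forall>k\<in>{1..n}. length (\<pi> k) = l' k" using conjunct2[OF fr(2)] ..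
  have S: "\<pi> \<in> extensional {1..n}" "k \<in> {1..n} \<Longrightarrow> \<pi> k \<noteq> []" "k \<in> {1..n} \<Longrightarrow> hd (\<pi> k) = A k"
    "k \<in> {1..n} \<Longrightarrow> last (\<pi> k) = B k" if "\<pi> \<in> \<Sigma>" for \<pi> k
    using conjunct1[OF fr(1)] that by simp_all
  have S': "\<pi> \<in> extensional {1..n}" "k \<in> {1..n} \<Longrightarrow> \<pi> k \<noteq> []" "k \<in> {1..n} \<Longrightarrow> hd (\<pi> k) = B k"
    "k \<in> {1..n} \<Longrightarrow> last (\<pi> k) = C k" if "\<pi> \<in> \<Sigma>'" for \<pi> k
    using conjunct1[OF fr(2)] that by simp_all
  let ?f = "\<lambda>(\<pi>, \<pi>'). \<lambda>j\<in>{1..n}. \<pi> j @ tl (\<pi>' j) :: vertex list"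
  show "framed n A C (\<Sigma> \<squnion>\<^bsub>n\<^esub> \<Sigma>')"
  proof -
    have "last (\<pi> k @ tl (\<pi>' k)) = C k" if "\<pi> \<in> \<Sigma>" "\<pi>' \<in> \<Sigma>'" "k \<in> {1..n}" for \<pi> \<pi>' k
      using S(4)[OF that(1,3)] S'(2-4)[OF that(2,3)] by (cases "\<pi>' k") (auto simp: last_append split: if_splits)
    moreover have "\<forall>\<pi>\<in>\<Sigma> \<squnion>\<^bsub>n\<^esub> \<Sigma>'. \<forall>k\<in>{1..n}. length (\<pi> k) = l k + (l' k - 1)"
      using l l' by (auto simp: concat_ensembles_def)
    ultimately show ?thesis using S S' unfolding framed_def
      by (intro conjI exI[of _ "\<lambda>k. l k + (l' k - 1)"]) (auto simp: concat_ensembles_def)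
  qed
  have inj: "inj_on ?f (\<Sigma> \<times> \<Sigma>')"
  proof (rule inj_onI, clarify)
    fix \<pi> \<pi>' \<rho> \<rho>' assume *: "\<pi> \<in> \<Sigma>" "\<pi>' \<in> \<Sigma>'" "\<rho> \<in> \<Sigma>" "\<rho>' \<in> \<Sigma>'"
      and eq: "(\<lambda>j\<in>{1..n}. \<pi> j @ tl (\<pi>' j)) = (\<lambda>j\<in>{1..n}. \<rho> j @ tl (\<rho>' j))"
    have "\<pi> k = \<rho> k \<and> \<pi>' k = \<rho>' k" if k: "k \<in> {1..n}" for k
    proof -
      have "\<pi> k @ tl (\<pi>' k) = \<rho> k @ tl (\<rho>' k)" using fun_cong[OF eq, of k] k by simp
      then have "\<pi> k = \<rho> k" "tl (\<pi>' k) = tl (\<rho>' k)" using bspec[OF bspec[OF l *(1)] k] bspec[OF bspec[OF l *(3)] k] by auto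
      then show ?thesis using S'[OF *(2)] S'[OF *(4)] k by (metis list.expand)
    qed
    then show "\<pi> = \<rho> \<and> \<pi>' = \<rho>'"
      using S(1)[OF *(1)] S(1)[OF *(3)] S'(1)[OF *(2)] S'(1)[OF *(4)] by (metis extensionalityI)
  qed
  have "wt n w (\<Sigma> \<squnion>\<^bsub>n\<^esub> \<Sigma>') = (\<Sum>(\<pi>, \<pi>')\<in>\<Sigma> \<times> \<Sigma>'. \<Prod>k=1..n. path_weight w (\<pi> k @ tl (\<pi>' k)))"
    unfolding wt_def concat_ensembles_image sum.reindex[OF inj] by (simp add: case_prod_unfold)
  also have "\<dots> = (\<Sum>(\<pi>, \<pi>')\<in>\<Sigma> \<times> \<Sigma>'. (\<Prod>k=1..n. path_weight w (\<pi> k)) * (\<Prod>k=1..n. path_weight w (\<pi>' k)))"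
  proof (intro sum.cong refl, clarify)
    fix \<pi> \<pi>' assume *: "\<pi> \<in> \<Sigma>" "\<pi>' \<in> \<Sigma>'"
    show "(\<Prod>k=1..n. path_weight w (\<pi> k @ tl (\<pi>' k))) = (\<Prod>k=1..n. path_weight w (\<pi> k)) * (\<Prod>k=1..n. path_weight w (\<pi>' k))"
      unfolding prod.distrib[symmetric]
      by (intro prod.cong refl path_weight_glue) (use S[OF *(1)] S'[OF *(2)] in auto)
  qed
  also have "\<dots> = wt n w \<Sigma> * wt n w \<Sigma>'"
    unfolding wt_def by (simp add: sum_product sum.cartesian_product case_prod_unfold)
  finally show "wt n w (\<Sigma> \<squnion>\<^bsub>n\<^esub> \<Sigma>') = wt n w \<Sigma> * wt n w \<Sigma>'" .
qed

section \<open>Paths that rise at every step\<close>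

text \<open>
  The common form of the steps of both kinds of diagonal paths.
\<close>

fun lstep :: "int \<Rightarrow> vertex \<Rightarrow> vertex \<Rightarrow> bool" where
  "lstep d (x, j) v \<longleftrightarrow> v = (x, j + 1) \<or> v = (x + d, j + 1)"

lemma e_step_eq: "e_step = lstep 1" and estar_step_eq: "estar_step = lstep (-1)"
  by (auto simp: fun_eq_iff)

lemma graded_lstep: "graded (lstep d) snd"
proof -
  have "finite {v. lstep d u v}" for u
    by (rule finite_subset[of _ "{(fst u, snd u + 1), (fst u + d, snd u + 1)}"]) (cases u, auto)
  then show ?thesis by (auto simp: graded_def)
qed

lemma graded_h_step: "graded h_step (\<lambda>v. fst v + snd v)"
proof -
  have "finite {v. h_step u v}" for u
    by (rule finite_subset[of _ "{(fst u, snd u + 1), (fst u + 1, snd u)}"]) (cases u, auto)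
  then show ?thesis by (auto simp: graded_def)
qed

lemma Weyl_strict: "mu \<in> Weyl n \<Longrightarrow> i \<in> {1..n} \<Longrightarrow> j \<in> {1..n} \<Longrightarrow> i < j \<Longrightarrow> mu j - int j < mu i - int i"
  using Weyl_mono[of mu n i j] by auto

text \<open>
  After the first step all paths are on level \<open>L + 1\<close>. Two paths that start in the right order can then
  at most meet, and disjointness excludes this; hence their positions form a signature again.
  Conversely only the starting points lie on level \<open>L\<close>, so adding them in front cannot create an
  intersection.
\<close>

lemma wt_first_step:
  assumes mu: "mu \<in> Weyl n" and d: "d \<in> {1, -1}" and M: "\<And>i. i \<in> {1..n} \<Longrightarrow> M i > L"
  shows "wt n w (path_ensemble (lstep d) n (pts mu (\<lambda>_. L)) (pts y M))
    = (\<Sum>kap\<in>strip n d mu. (\<Prod>i=1..n. w (mu i - int i, L) (kap i - int i, L + 1)) *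
          wt n w (path_ensemble (lstep d) n (pts kap (\<lambda>_. L + 1)) (pts y M)))"
proof -
  let ?E = "\<lambda>mu L. path_ensemble (lstep d) n (pts mu (\<lambda>_. L)) (pts y M)"
  let ?i = "\<lambda>(kap :: nat \<Rightarrow> int, \<rho>). \<lambda>k\<in>{1..n}. (mu k - int k, L) # \<rho> k"
  let ?j = "\<lambda>\<pi>. (\<lambda>k\<in>{1..n}. fst (hd (tl (\<pi> k))) + int k, \<lambda>k\<in>{1..n}. tl (\<pi> k))"
  have split: "\<exists>x. \<pi> k = (mu k - int k, L) # tl (\<pi> k) \<and> tl (\<pi> k) \<noteq> [] \<and> hd (tl (\<pi> k)) = (x, L + 1)
      \<and> x \<in> {mu k - int k, mu k - int k + d} \<and> is_path (lstep d) (x, L + 1) (pts y M k) (tl (\<pi> k))"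
    if "\<pi> \<in> ?E mu L" "k \<in> {1..n}" for \<pi> k
  proof -
    have p: "is_path (lstep d) (mu k - int k, L) (pts y M k) (\<pi> k)"
      using that by (auto simp: path_ensemble_iff pts_def)
    have "pts y M k \<noteq> (mu k - int k, L)" using M[OF that(2)] by (auto simp: pts_def)
    then show ?thesis using p by (cases "\<pi> k") (auto simp: is_path_Cons split: if_splits)
  qed
  have j_in: "?j \<pi> \<in> Sigma (strip n d mu) (\<lambda>kap. ?E kap (L + 1))" if \<pi>: "\<pi> \<in> ?E mu L" for \<pi>
  proof -
    define kap where "kap = fst (?j \<pi>)"
    have hd: "hd (tl (\<pi> k)) = (kap k - int k, L + 1)" "tl (\<pi> k) \<noteq> []" "kap k \<in> {mu k, mu k + d}"
       "is_path (lstep d) (kap k - int k, L + 1) (pts y M k) (tl (\<pi> k))" if "k \<in> {1..n}" for k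
      using split[OF \<pi> that] that by (auto simp: kap_def)
    have sub: "set (tl (\<pi> k)) \<subseteq> set (\<pi> k)" for k by (cases "\<pi> k") auto
    have ne: "kap i - int i \<noteq> kap j - int j" if "i \<in> {1..n}" "j \<in> {1..n}" "i \<noteq> j" for i j
    proof
      (* otherwise both paths would pass through the same vertex of level L + 1 *)
      assume "kap i - int i = kap j - int j"
      then have "hd (tl (\<pi> i)) \<in> set (\<pi> i) \<inter> set (\<pi> j)"
        using hd(1,2)[OF that(1)] hd(1,2)[OF that(2)] sub by (metis IntI hd_in_set subsetD)
      moreover have "set (\<pi> i) \<inter> set (\<pi> j) = {}"
        using \<pi> that unfolding path_ensemble_iff by blast
      ultimately show False by blast
    qed
    have "kap \<in> Weyl n"
    proof (rule WeylI_adjacent)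
      show "kap \<in> {1..n} \<rightarrow>\<^sub>E UNIV" by (simp add: kap_def PiE_iff)
      fix i assume i: "1 \<le> i" "i < n"
      have "mu (Suc i) \<le> mu i" using Weyl_mono[OF mu, of i "Suc i"] i by simp
      then show "kap (Suc i) \<le> kap i"
        using hd(3)[of i] hd(3)[of "Suc i"] ne[of i "Suc i"] i d by auto
    qed
    from this Weyl_ext[OF this] have "kap \<in> strip n d mu" using hd(3) by (simp add: strip_def PiE_iff)
    moreover have "(\<lambda>k\<in>{1..n}. tl (\<pi> k)) \<in> ?E kap (L + 1)"
      unfolding path_ensemble_iff
    proof (intro conjI ballI impI)
      fix k assume "k \<in> {1..n}"
      then show "is_path (lstep d) (pts kap (\<lambda>_. L + 1) k) (pts y M k) ((\<lambda>k\<in>{1..n}. tl (\<pi> k)) k)"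
        using hd(4)[of k] by (simp add: pts_def)
    next
      fix i j assume ij: "i \<in> {1..n}" "j \<in> {1..n}" "i \<noteq> j"
      then have "set (\<pi> i) \<inter> set (\<pi> j) = {}" using \<pi> unfolding path_ensemble_iff by blast
      then show "set ((\<lambda>k\<in>{1..n}. tl (\<pi> k)) i) \<inter> set ((\<lambda>k\<in>{1..n}. tl (\<pi> k)) j) = {}"
        using sub[of i] sub[of j] ij by auto
    qed simp
    ultimately show ?thesis by (simp add: kap_def)
  qed
  have i_in: "?i (kap, \<rho>) \<in> ?E mu L" if kap: "kap \<in> strip n d mu" and \<rho>: "\<rho> \<in> ?E kap (L + 1)" for kap \<rho>
  proof -
    have p: "is_path (lstep d) (kap k - int k, L + 1) (pts y M k) (\<rho> k)" if "k \<in> {1..n}" for k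
      using \<rho> that by (auto simp: path_ensemble_iff pts_def)
    have "is_path (lstep d) (pts mu (\<lambda>_. L) k) (pts y M k) ((mu k - int k, L) # \<rho> k)" if "k \<in> {1..n}" for k
      using p[OF that] that strip_cases[OF kap, of k] by (auto simp: pts_def is_path_def successively_Cons)
    moreover have "(x, L) \<notin> set (\<rho> k)" if "k \<in> {1..n}" for x k
      using graded_rank[OF graded_lstep p[OF that], of "(x, L)"] by auto
    moreover have "set (\<rho> j) \<inter> set (\<rho> k) = {}" if "j \<in> {1..n}" "k \<in> {1..n}" "j \<noteq> k" for j k
      using \<rho> that by (auto simp: path_ensemble_iff)
    moreover have "mu j - int j \<noteq> mu k - int k" if "j \<in> {1..n}" "k \<in> {1..n}" "j \<noteq> k" for j k
      using Weyl_strict[OF mu, of j k] Weyl_strict[OF mu, of k j] that by linarith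
    ultimately show ?thesis by (auto simp: path_ensemble_iff)
  qed
  have "wt n w (?E mu L) = (\<Sum>(kap, \<rho>)\<in>Sigma (strip n d mu) (\<lambda>kap. ?E kap (L + 1)).
      (\<Prod>i=1..n. w (mu i - int i, L) (kap i - int i, L + 1)) * (\<Prod>i=1..n. path_weight w (\<rho> i)))"
    unfolding wt_def
  proof (rule sum.reindex_bij_witness[of _ ?i ?j])
    fix \<pi> assume \<pi>: "\<pi> \<in> ?E mu L"
    show "?i (?j \<pi>) = \<pi>"
    proof (rule extensionalityI[where A = "{1..n}"])
      fix k assume "k \<in> {1..n}"
      then show "?i (?j \<pi>) k = \<pi> k" using split[OF \<pi>] by fastforce
    qed (use \<pi> in \<open>auto simp: path_ensemble_iff\<close>)
    show "?j \<pi> \<in> Sigma (strip n d mu) (\<lambda>kap. ?E kap (L + 1))" by (rule j_in[OF \<pi>])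
    show "(case ?j \<pi> of (kap, \<rho>) \<Rightarrow> (\<Prod>i=1..n. w (mu i - int i, L) (kap i - int i, L + 1)) * (\<Prod>i=1..n. path_weight w (\<rho> i)))
      = (\<Prod>k=1..n. path_weight w (\<pi> k))"
      unfolding prod.case prod.distrib[symmetric]
    proof (rule prod.cong[OF refl])
      fix k assume k: "k \<in> {1..n}"
      then obtain x where "\<pi> k = (mu k - int k, L) # tl (\<pi> k)" "tl (\<pi> k) \<noteq> []" "hd (tl (\<pi> k)) = (x, L + 1)"
        using split[OF \<pi> k] by auto
      then obtain \<rho> where "\<pi> k = (mu k - int k, L) # (x, L + 1) # \<rho>" by (metis list.collapse)
      then show "w (mu k - int k, L) ((\<lambda>k\<in>{1..n}. fst (hd (tl (\<pi> k))) + int k) k - int k, L + 1) *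
          path_weight w ((\<lambda>k\<in>{1..n}. tl (\<pi> k)) k) = path_weight w (\<pi> k)" using k by simp
    qed
  next
    fix b assume "b \<in> Sigma (strip n d mu) (\<lambda>kap. ?E kap (L + 1))"
    then obtain kap \<rho> where b: "b = (kap, \<rho>)" "kap \<in> strip n d mu" "\<rho> \<in> ?E kap (L + 1)" by auto
    then show "?i b \<in> ?E mu L" using i_in by simp
    have "hd (\<rho> k) = (kap k - int k, L + 1)" if "k \<in> {1..n}" for k
      using b(3) that by (auto simp: path_ensemble_iff is_path_def pts_def)
    moreover have "kap \<in> extensional {1..n}" using strip_Weyl[OF b(2)] by (rule Weyl_ext)
    moreover have "\<rho> \<in> extensional {1..n}" using b(3) by (auto simp: path_ensemble_iff)
    ultimately show "?j (?i b) = b" by (auto simp: b(1) restrict_def extensional_def fun_eq_iff)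
  qed
  also have "\<dots> = (\<Sum>kap\<in>strip n d mu. (\<Prod>i=1..n. w (mu i - int i, L) (kap i - int i, L + 1)) * wt n w (?E kap (L + 1)))"
    unfolding wt_def sum_distrib_left
    by (rule sum.Sigma[symmetric]) (auto intro: finite_path_ensemble[OF graded_lstep])
  finally show ?thesis .
qed

lemma wt_strips:
  assumes "lam \<in> Weyl n" "mu \<in> Weyl n"
    and "\<And>x j. j < m \<Longrightarrow> w (x, L + int j) (x, L + int j + 1) = 1"
    and "\<And>x j. j < m \<Longrightarrow> w (x, L + int j) (x - 1, L + int j + 1) = p (r + m - j)"
  shows "wt n w (ePi_star n (pts lam (\<lambda>_. L)) (pts mu (\<lambda>_. L + int m))) = strips_weight p r n m lam mu"
  using assms(1,3,4)
proof (induction m arbitrary: lam L)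
  case 0
  let ?E = "path_ensemble (lstep (-1)) n (pts lam (\<lambda>_. L)) (pts mu (\<lambda>_. L))"
  have triv: "is_path (lstep (-1)) (pts lam (\<lambda>_. L) k) (pts mu (\<lambda>_. L) k) \<pi>
     \<longleftrightarrow> \<pi> = [(lam k - int k, L)] \<and> lam k = mu k" for k \<pi>
    by (subst graded_trivial[OF graded_lstep]) (auto simp: pts_def)
  show ?case
  proof (cases "lam = mu")
    case True
    have "?E = {\<lambda>k\<in>{1..n}. [(lam k - int k, L)]}" (is "_ = {?p}")
    proof -
      have "\<pi> = ?p" if "\<pi> \<in> ?E" for \<pi>
        by (rule extensionalityI[where A = "{1..n}"]) (use that in \<open>auto simp: path_ensemble_iff triv\<close>)
      moreover have "lam j - int j \<noteq> lam k - int k" if "j \<in> {1..n}" "k \<in> {1..n}" "j \<noteq> k" for j k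
        using Weyl_strict[OF 0(1), of j k] Weyl_strict[OF 0(1), of k j] that by linarith
      then have "?p \<in> ?E" using True triv[unfolded True] by (auto simp: path_ensemble_iff)
      ultimately show ?thesis by blast
    qed
    then show ?thesis unfolding estar_step_eq by (simp add: wt_def True)
  next
    case False
    then obtain k where "k \<in> {1..n}" "lam k \<noteq> mu k"
      using extensionalityI[OF Weyl_ext[OF 0(1)] Weyl_ext[OF assms(2)]] by blast
    then have "?E = {}" by (auto simp: path_ensemble_iff triv)
    then show ?thesis unfolding estar_step_eq by (simp add: wt_def False)
  qed
next
  case (Suc m)
  have IH: "wt n w (ePi_star n (pts kap (\<lambda>_. L + 1)) (pts mu (\<lambda>_. L + 1 + int m))) = strips_weight p r n m kap mu"
    if "kap \<in> Weyl n" for kap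
  proof (rule Suc.IH[OF that])
    fix x j assume "j < m"
    then show "w (x, L + 1 + int j) (x, L + 1 + int j + 1) = 1"
        "w (x, L + 1 + int j) (x - 1, L + 1 + int j + 1) = p (r + m - j)"
      using Suc.prems(2,3)[of "Suc j" x] by (simp_all add: algebra_simps)
  qed
  have L: "L + int (Suc m) = L + 1 + int m" by simp
  have "wt n w (ePi_star n (pts lam (\<lambda>_. L)) (pts mu (\<lambda>_. L + int (Suc m))))
     = (\<Sum>kap\<in>strip n (-1) lam. (\<Prod>i=1..n. w (lam i - int i, L) (kap i - int i, L + 1)) *
          wt n w (ePi_star n (pts kap (\<lambda>_. L + 1)) (pts mu (\<lambda>_. L + 1 + int m))))"
    unfolding estar_step_eq L by (rule wt_first_step[OF Suc.prems(1)]) auto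
  also have "\<dots> = strips_weight p r n (Suc m) lam mu"
    unfolding strips_weight.simps
  proof (rule sum.cong[OF refl])
    fix kap assume kap: "kap \<in> strip n (-1) lam"
    have "w (lam i - int i, L) (kap i - int i, L + 1) = p (Suc (r + m)) powi (lam i - kap i)" if "i \<in> {1..n}" for i
    proof -
      have "kap i = lam i \<or> kap i = lam i + - 1" by (rule strip_cases[OF kap]) (use that in auto)
      then consider "kap i = lam i" | "kap i = lam i - 1" by linarith
      then show ?thesis
      proof cases
        case 2
        then have eq: "kap i - int i = lam i - int i - 1" "lam i - kap i = 1" by simp_all
        show ?thesis unfolding eq using Suc.prems(3)[of 0 "lam i - int i"] by simp
      qed (use Suc.prems(2)[of 0 "lam i - int i"] in simp)
    qed
    then show "(\<Prod>i=1..n. w (lam i - int i, L) (kap i - int i, L + 1)) *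
          wt n w (ePi_star n (pts kap (\<lambda>_. L + 1)) (pts mu (\<lambda>_. L + 1 + int m)))
       = (\<Prod>i=1..n. p (Suc (r + m)) powi (lam i - kap i)) * strips_weight p r n m kap mu"
      unfolding IH[OF strip_Weyl[OF kap]] by simp
  qed
  finally show ?case .
qed

lemma strip_cong: "(\<And>i. i \<in> {1..n} \<Longrightarrow> x i = z i) \<Longrightarrow> strip n d x = strip n d z"
  unfolding strip_def by (intro arg_cong2[where f = "(\<inter>)"] refl PiE_cong) simp

lemma Weyl_restrict: "mu \<in> Weyl (Suc n) \<Longrightarrow> restrict mu {1..n} \<in> Weyl n"
  by (auto simp: Weyl_def)

text \<open>
  A path that ends where it starts can be left out: it occupies only its starting point, which the other
  paths, starting at different points of the same rank, do not meet.
\<close>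

lemma wt_ensemble_trivial_last:
  assumes "graded step rk" and last: "A (Suc n) = B (Suc n)"
    and rk: "\<And>k. k \<in> {1..n} \<Longrightarrow> rk (A k) = rk (A (Suc n)) \<and> A k \<noteq> A (Suc n)"
  shows "wt (Suc n) w (path_ensemble step (Suc n) A B) = wt n w (path_ensemble step n A B)"
  unfolding wt_def
proof (rule sum.reindex_bij_witness[of _ "\<lambda>\<rho>. \<rho>(Suc n := [A (Suc n)])" "\<lambda>\<pi>. restrict \<pi> {1..n}"])
  fix \<pi> assume \<pi>: "\<pi> \<in> path_ensemble step (Suc n) A B"
  have "is_path step (A (Suc n)) (B (Suc n)) (\<pi> (Suc n))" using \<pi> by (simp add: path_ensemble_iff)
  then have 1: "\<pi> (Suc n) = [A (Suc n)]" using graded_trivial[OF assms(1)] last by simp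
  show "(restrict \<pi> {1..n})(Suc n := [A (Suc n)]) = \<pi>"
  proof (rule extensionalityI[where A = "{1..Suc n}"])
    show "(restrict \<pi> {1..n})(Suc n := [A (Suc n)]) \<in> extensional {1..Suc n}" by (auto simp: extensional_def)
    show "\<pi> \<in> extensional {1..Suc n}" using \<pi> by (simp add: path_ensemble_iff)
    fix k assume "k \<in> {1..Suc n}"
    then show "((restrict \<pi> {1..n})(Suc n := [A (Suc n)])) k = \<pi> k" using 1 by (cases "k = Suc n") auto
  qed
  show "restrict \<pi> {1..n} \<in> path_ensemble step n A B"
    using \<pi> by (simp add: path_ensemble_iff)
  show "(\<Prod>k=1..n. path_weight w (restrict \<pi> {1..n} k)) = (\<Prod>k=1..Suc n. path_weight w (\<pi> k))"
    by (simp add: 1)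
next
  fix \<rho> assume \<rho>: "\<rho> \<in> path_ensemble step n A B"
  have out: "A (Suc n) \<notin> set (\<rho> k)" if "k \<in> {1..n}" for k
  proof -
    have "is_path step (A k) (B k) (\<rho> k)" using \<rho> that by (simp add: path_ensemble_iff)
    then show ?thesis using graded_rank[OF assms(1), of "A k" "B k" "\<rho> k" "A (Suc n)"] rk[OF that] by auto
  qed
  show "restrict (\<rho>(Suc n := [A (Suc n)])) {1..n} = \<rho>"
  proof (rule extensionalityI[where A = "{1..n}"])
    show "\<rho> \<in> extensional {1..n}" using \<rho> by (simp add: path_ensemble_iff)
  qed auto
  show "\<rho>(Suc n := [A (Suc n)]) \<in> path_ensemble step (Suc n) A B" (is "?r \<in> _")
    unfolding path_ensemble_iff
  proof (intro conjI ballI impI)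
    show "?r \<in> extensional {1..Suc n}" using \<rho> by (auto simp: path_ensemble_iff extensional_def)
    fix k assume k: "k \<in> {1..Suc n}"
    show "is_path step (A k) (B k) (?r k)"
    proof (cases "k = Suc n")
      case True
      then show ?thesis using last by (simp add: is_path_Cons)
    next
      case False
      then have "k \<in> {1..n}" using k by auto
      then show ?thesis using \<rho> False unfolding path_ensemble_iff by simp
    qed
  next
    fix j k assume jk: "j \<in> {1..Suc n}" "k \<in> {1..Suc n}" "j \<noteq> k"
    consider "j = Suc n" "k \<in> {1..n}" | "k = Suc n" "j \<in> {1..n}" | "j \<in> {1..n}" "k \<in> {1..n}"
      using jk by fastforce
    then show "set (?r j) \<inter> set (?r k) = {}"
    proof cases
      case 1 then show ?thesis using out[of k] jk(3) by simp
    next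
      case 2 then show ?thesis using out[of j] jk(3) by simp
    next
      case 3
      then have "set (\<rho> j) \<inter> set (\<rho> k) = {}" using \<rho> jk(3) unfolding path_ensemble_iff by blast
      then show ?thesis using 3 by simp
    qed
  qed
qed

text \<open>
  The number of paths drops by one at every level, since path \<open>i\<close> stops after \<open>n - i\<close> steps.
\<close>

lemma wt_inverse:
  assumes "mu \<in> Weyl n"
    and "\<And>x j. j + 1 < n \<Longrightarrow> w (x, L + int j) (x, L + int j + 1) = 1"
    and "\<And>x j. j + 1 < n \<Longrightarrow> w (x, L + int j) (x + 1, L + int j + 1) = - q (n - j)"
  shows "wt n w (ePi n (pts mu (\<lambda>_. L)) (pts y (\<lambda>i. L + int n - int i))) = inverse_weight q n y mu"
  using assms
proof (induction n arbitrary: mu L)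
  case 0
  have "path_ensemble e_step 0 A B = {\<lambda>_. undefined}" for A B
    by (auto simp: path_ensemble_iff)
  then show ?case by (simp add: wt_def)
next
  case (Suc n)
  let ?A = "pts mu (\<lambda>_. L)" and ?B = "pts y (\<lambda>i. L + int (Suc n) - int i)"
  show ?case
  proof (cases "mu (Suc n) = y (Suc n)")
    case False
    have no: "\<not> is_path (lstep 1) (?A (Suc n)) (?B (Suc n)) \<pi>" for \<pi>
      using False by (subst graded_trivial[OF graded_lstep]) (auto simp: pts_def)
    have "\<pi> \<notin> ePi (Suc n) ?A ?B" for \<pi>
    proof
      assume "\<pi> \<in> ePi (Suc n) ?A ?B"
      then have "\<forall>k\<in>{1..Suc n}. is_path (lstep 1) (?A k) (?B k) (\<pi> k)"
        unfolding e_step_eq path_ensemble_iff by blast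
      then have "is_path (lstep 1) (?A (Suc n)) (?B (Suc n)) (\<pi> (Suc n))" by (rule bspec) simp
      then show False using no by blast
    qed
    then have "ePi (Suc n) ?A ?B = {}" by blast
    then show ?thesis using False by (simp add: wt_def)
  next
    case True
    define z where "z = restrict mu {1..n}"
    have zi: "z i = mu i" if "i \<in> {1..n}" for i using that by (simp add: z_def)
    have z: "z \<in> Weyl n" unfolding z_def by (rule Weyl_restrict[OF Suc.prems(1)])
    have IH: "wt n w (ePi n (pts kap (\<lambda>_. L + 1)) (pts y (\<lambda>i. L + 1 + int n - int i))) = inverse_weight q n y kap"
      if "kap \<in> Weyl n" for kap
    proof (rule Suc.IH[OF that])
      fix x j assume "j + 1 < n"
      then show "w (x, L + 1 + int j) (x, L + 1 + int j + 1) = 1"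
          "w (x, L + 1 + int j) (x + 1, L + 1 + int j + 1) = - q (n - j)"
        using Suc.prems(2,3)[of "Suc j" x] by (simp_all add: algebra_simps)
    qed
    have "wt (Suc n) w (ePi (Suc n) ?A ?B) = wt n w (ePi n ?A ?B)"
      unfolding e_step_eq
    proof (rule wt_ensemble_trivial_last[OF graded_lstep])
      show "?A (Suc n) = ?B (Suc n)" using True by (simp add: pts_def)
      fix k assume "k \<in> {1..n}"
      then show "snd (?A k) = snd (?A (Suc n)) \<and> ?A k \<noteq> ?A (Suc n)"
        using Weyl_strict[OF Suc.prems(1), of k "Suc n"] by (auto simp: pts_def)
    qed
    also have "ePi n ?A ?B = ePi n (pts z (\<lambda>_. L)) (pts y (\<lambda>i. L + 1 + int n - int i))"
      by (rule path_ensemble_cong) (simp add: pts_def zi)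
    also have "wt n w \<dots> = (\<Sum>kap\<in>strip n 1 z. (\<Prod>i=1..n. w (z i - int i, L) (kap i - int i, L + 1)) *
          wt n w (ePi n (pts kap (\<lambda>_. L + 1)) (pts y (\<lambda>i. L + 1 + int n - int i))))"
      unfolding e_step_eq by (rule wt_first_step[OF z]) auto
    also have "\<dots> = (\<Sum>kap\<in>strip n 1 z. (\<Prod>i=1..n. (- q (Suc n)) powi (kap i - mu i)) * inverse_weight q n y kap)"
    proof (rule sum.cong[OF refl])
      fix kap assume kap: "kap \<in> strip n 1 z"
      have "w (z i - int i, L) (kap i - int i, L + 1) = (- q (Suc n)) powi (kap i - mu i)" if i: "i \<in> {1..n}" for i
      proof -
        have "kap i = z i \<or> kap i = z i + 1" by (rule strip_cases[OF kap]) (use i in auto)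
        then consider "kap i = mu i" | "kap i = mu i + 1" using zi[OF i] by auto
        then show ?thesis
        proof cases
          case 1
          then show ?thesis using Suc.prems(2)[of 0 "mu i - int i"] i zi[OF i] by simp
        next
          case 2
          then have eq: "kap i - int i = mu i - int i + 1" "kap i - mu i = 1" by simp_all
          show ?thesis unfolding eq zi[OF i] using i Suc.prems(3)[of 0 "mu i - int i"] by simp
        qed
      qed
      then show "(\<Prod>i=1..n. w (z i - int i, L) (kap i - int i, L + 1)) *
          wt n w (ePi n (pts kap (\<lambda>_. L + 1)) (pts y (\<lambda>i. L + 1 + int n - int i)))
         = (\<Prod>i=1..n. (- q (Suc n)) powi (kap i - mu i)) * inverse_weight q n y kap"
        unfolding IH[OF strip_Weyl[OF kap]] by simp
    qed
    also have "strip n 1 z = strip n 1 mu" by (rule strip_cong) (rule zi)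
    finally show ?thesis using True by simp
  qed
qed

section \<open>Paths with horizontal steps\<close>

definition hrun :: "int \<Rightarrow> int \<Rightarrow> int \<Rightarrow> vertex list" where
  "hrun l a b = map (\<lambda>x. (x, l)) [a..b]"

lemma set_hrun: "set (hrun l a b) = {a..b} \<times> {l}"
  by (auto simp: hrun_def)

lemma hrun_rec: "a \<le> b \<Longrightarrow> hrun l a b = (a, l) # hrun l (a + 1) b"
  by (simp add: hrun_def upto_rec1)

lemma hrun_single [simp]: "hrun l a a = [(a, l)]"
  by (simp add: hrun_def)

lemma h_step_levels:
  "is_path h_step a b \<pi> \<Longrightarrow> v \<in> set \<pi> \<Longrightarrow> snd a \<le> snd v \<and> snd v \<le> snd b"
proof (induction \<pi> arbitrary: a v)
  case (Cons u \<pi>)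
  show ?case
  proof (cases "\<pi> = []")
    case False
    then have p: "is_path h_step (hd \<pi>) b \<pi>" and s: "h_step a (hd \<pi>)" and u: "u = a"
      using Cons.prems by (auto simp: is_path_Cons)
    have "snd a \<le> snd (hd \<pi>)" using s by (cases a) auto
    moreover have "snd (hd \<pi>) \<le> snd b" using Cons.IH[OF p, of "hd \<pi>"] False by simp
    ultimately show ?thesis using Cons.IH[OF p, of v] Cons.prems(2) u by auto
  qed (use Cons.prems in \<open>auto simp: is_path_Cons\<close>)
qed simp

lemma is_path_hrun: "a \<le> b \<Longrightarrow> is_path h_step (a, l) (b, l) (hrun l a b)"
proof (induction a b rule: upto.induct)
  case (1 a b)
  show ?case
  proof (cases "a = b")
    case False
    then have "a + 1 \<le> b" using 1 by simp
    then show ?thesis using 1 by (simp add: hrun_rec is_path_Cons)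
  qed (simp add: is_path_Cons)
qed

lemma is_path_horizontal:
  "is_path h_step (a, l) (b, l) \<pi> \<longleftrightarrow> a \<le> b \<and> \<pi> = hrun l a b"
proof
  show "is_path h_step (a, l) (b, l) \<pi> \<Longrightarrow> a \<le> b \<and> \<pi> = hrun l a b"
  proof (induction \<pi> arbitrary: a)
    case (Cons u \<pi>)
    show ?case
    proof (cases "\<pi> = []")
      case False
      then have p: "is_path h_step (hd \<pi>) (b, l) \<pi>" and s: "h_step (a, l) (hd \<pi>)" and u: "u = (a, l)"
        using Cons.prems by (auto simp: is_path_Cons)
      have "snd (hd \<pi>) \<le> l" using h_step_levels[OF p, of "hd \<pi>"] False by simp
      with s have hd: "hd \<pi> = (a + 1, l)" by auto
      then have "a + 1 \<le> b \<and> \<pi> = hrun l (a + 1) b" using Cons.IH[of "a + 1"] p by simp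
      then show ?thesis using u hrun_rec[of a b] by simp
    qed (use Cons.prems in \<open>auto simp: is_path_Cons\<close>)
  qed simp
qed (auto intro: is_path_hrun)

lemma is_path_append_hrun:
  assumes "is_path h_step A (c, l) \<pi>" "c \<le> b"
  shows "is_path h_step A (b, l + 1) (\<pi> @ hrun (l + 1) c b)"
  using assms(1) is_path_hrun[OF assms(2), of "l + 1"] unfolding is_path_def
  by (auto simp: successively_append_iff)

text \<open>
  A path with up and right steps enters the level \<open>l + 1\<close> at a unique position \<open>c\<close> and stays there.
\<close>

lemma is_path_last_level:
  assumes "i \<le> l" "is_path h_step (a, i) (b, l + 1) \<pi>"
  shows "\<exists>c \<rho>. c \<le> b \<and> is_path h_step (a, i) (c, l) \<rho> \<and> \<pi> = \<rho> @ hrun (l + 1) c b"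
  using assms
proof (induction \<pi> arbitrary: a i)
  case (Cons u \<pi>)
  have ne: "\<pi> \<noteq> []" using Cons.prems by (auto simp: is_path_Cons)
  then have p: "is_path h_step (hd \<pi>) (b, l + 1) \<pi>" and s: "h_step (a, i) (hd \<pi>)" and u: "u = (a, i)"
    using Cons.prems by (auto simp: is_path_Cons)
  consider "hd \<pi> = (a, l + 1)" "i = l" | j a' where "hd \<pi> = (a', j)" "j \<le> l" "h_step (a, i) (a', j)"
    using s Cons.prems(1) by (cases "hd \<pi>") force
  then show ?case
  proof cases
    case 1
    then have "a \<le> b \<and> \<pi> = hrun (l + 1) a b" using p is_path_horizontal by simp
    then show ?thesis using u 1
      by (intro exI[of _ a] exI[of _ "[(a, l)]"]) (simp add: is_path_Cons)
  next
    case 2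
    then obtain c \<rho> where "c \<le> b" "is_path h_step (a', j) (c, l) \<rho>" "\<pi> = \<rho> @ hrun (l + 1) c b"
      using Cons.IH[of j a'] p by auto
    then show ?thesis using u 2
      by (intro exI[of _ c] exI[of _ "u # \<rho>"]) (auto simp: is_path_def successively_Cons)
  qed
qed simp

lemma path_weight_hrun:
  assumes "\<And>x. w (x, l) (x + 1, l) = Q" "Q \<noteq> 0"
  shows "a \<le> b \<Longrightarrow> path_weight w (hrun l a b) = Q powi (b - a)"
proof (induction a b rule: upto.induct)
  case (1 a b)
  show ?case
  proof (cases "a = b")
    case False
    then have ab: "a + 1 \<le> b" using 1 by simp
    then have "path_weight w (hrun l a b) = Q * path_weight w (hrun l (a + 1) b)"
      using 1 assms(1) by (simp add: hrun_rec[of a b] hrun_rec[of "a + 1" b])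
    also have "\<dots> = Q * Q powi (b - (a + 1))" using 1 ab by simp
    also have "\<dots> = Q powi (b - a)"
      using power_int_add_1[of Q "b - (a + 1)"] assms(2) by (simp add: mult.commute)
    finally show ?thesis .
  qed simp
qed

text \<open>
  The condition that \<open>hPi_up\<close> imposes on a single path; \<open>n\<close> is the top level.
\<close>

definition up_path :: "nat \<Rightarrow> vertex \<Rightarrow> vertex \<Rightarrow> vertex list \<Rightarrow> bool" where
  "up_path n a b \<pi> \<longleftrightarrow> is_path h_step a b \<pi> \<and>
     ((\<exists>x j \<rho>. \<pi> = (x, j) # (x, j + 1) # \<rho>) \<or> (\<exists>x. \<pi> = [(x, int n)]))"

lemma hPi_up_iff:
  "\<pi> \<in> hPi_up n A B \<longleftrightarrow> \<pi> \<in> extensional {1..n} \<and> (\<forall>k\<in>{1..n}. up_path n (A k) (B k) (\<pi> k)) \<and>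
     (\<forall>j\<in>{1..n}. \<forall>k\<in>{1..n}. j \<noteq> k \<longrightarrow> set (\<pi> j) \<inter> set (\<pi> k) = {})"
  unfolding hPi_up_def up_path_def path_ensemble_iff mem_Collect_eq ball_conj_distrib by blast

lemma up_path_top: "up_path n (a, int n) (b, int n) \<pi> \<longleftrightarrow> \<pi> = [(a, int n)] \<and> a = b"
proof
  assume up: "up_path n (a, int n) (b, int n) \<pi>"
  then have "a \<le> b" "\<pi> = hrun (int n) a b" by (simp_all add: up_path_def is_path_horizontal)
  moreover from this have "v \<in> set \<pi> \<Longrightarrow> snd v = int n" for v by (auto simp: set_hrun)
  ultimately show "\<pi> = [(a, int n)] \<and> a = b"
    using up by (cases "a = b") (fastforce simp: up_path_def hrun_rec[of a b] hrun_rec[of "a + 1" b])+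
qed (simp add: up_path_def is_path_Cons)

text \<open>
  Extending a path to the next level does not affect its first step, with one exception: a trivial path on
  level \<open>n\<close> becomes one that starts with a vertical step. Both are admitted, each for its top level.
\<close>

lemma up_path_append:
  assumes "is_path h_step (a, i) (c, int n) \<rho>" "c \<le> b" "i \<le> int n"
  shows "up_path (Suc n) (a, i) (b, int (Suc n)) (\<rho> @ hrun (int (Suc n)) c b) \<longleftrightarrow> up_path n (a, i) (c, int n) \<rho>"
proof -
  have p: "is_path h_step (a, i) (b, int (Suc n)) (\<rho> @ hrun (int (Suc n)) c b)"
    using is_path_append_hrun[OF assms(1,2)] by (simp add: add.commute)
  obtain rest where h: "hrun (int (Suc n)) c b = (c, int n + 1) # rest"
    using hrun_rec[OF assms(2), of "int (Suc n)"] by (auto simp: add.commute)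
  show ?thesis
  proof (cases "tl \<rho>")
    case Nil
    then have "\<rho> = [(a, i)]" "i = int n" "a = c" using assms(1) by (cases \<rho>; auto simp: is_path_Cons)+
    then show ?thesis using assms(1) p unfolding up_path_def h by simp
  next
    case (Cons v \<rho>')
    then have "\<rho> = (a, i) # v # \<rho>'" using assms(1) by (cases \<rho>) (auto simp: is_path_Cons)
    then show ?thesis using assms(1) p by (auto simp: up_path_def)
  qed
qed

text \<open>
  Let \<open>kap k - k\<close> be the position at which path \<open>k\<close> enters the top level. Cutting all paths there leaves an
  ensemble of the same kind with one level less, and the path \<open>n + 1\<close> that starts on the top level has to be
  trivial. The runs on the top level are disjoint exactly if \<open>kap\<close> interlaces with \<open>lam\<close>, so this is the
  recursion of the Gelfand-Tsetlin patterns, \<open>kap\<close> being the row below the top row.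
\<close>

lemma wt_up:
  assumes lam: "lam \<in> Weyl n"
    and up: "\<And>x j. 1 \<le> j \<Longrightarrow> j < n \<Longrightarrow> w (x, int j) (x, int j + 1) = 1"
    and hor: "\<And>x j. 1 \<le> j \<Longrightarrow> j \<le> n \<Longrightarrow> w (x, int j) (x + 1, int j) = q j"
    and q: "\<And>j. 1 \<le> j \<Longrightarrow> j \<le> n \<Longrightarrow> q j > 0"
  shows "wt n w (hPi_up n (pts y (\<lambda>i. int i)) (pts lam (\<lambda>_. int n))) = gt_weight q n lam y"
  using assms
proof (induction n arbitrary: lam)
  case 0
  have "hPi_up 0 A B = {\<lambda>_. undefined}" for A B by (auto simp: hPi_up_iff)
  then show ?case by (simp add: wt_def)
next
  case (Suc n)
  note lam = Suc.prems(1)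
  let ?N = "int (Suc n)"
  let ?E = "hPi_up (Suc n) (pts y (\<lambda>i. int i)) (pts lam (\<lambda>_. ?N))"
  let ?F = "\<lambda>kap. hPi_up n (pts y (\<lambda>i. int i)) (pts kap (\<lambda>_. int n))"
  have top: "\<pi> (Suc n) = [(y (Suc n) - ?N, ?N)] \<and> y (Suc n) = lam (Suc n)" if "\<pi> \<in> ?E" for \<pi>
  proof -
    have "\<forall>k\<in>{1..Suc n}. up_path (Suc n) (pts y (\<lambda>i. int i) k) (pts lam (\<lambda>_. ?N) k) (\<pi> k)"
      using that unfolding hPi_up_iff by blast
    then have "up_path (Suc n) (pts y (\<lambda>i. int i) (Suc n)) (pts lam (\<lambda>_. ?N) (Suc n)) (\<pi> (Suc n))"
      by (rule bspec) simp
    then have "up_path (Suc n) (y (Suc n) - ?N, ?N) (lam (Suc n) - ?N, ?N) (\<pi> (Suc n))"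
      unfolding pts_def .
    then show ?thesis using up_path_top[of "Suc n"] by simp
  qed
  show ?case
  proof (cases "lam (Suc n) = y (Suc n)")
    case False
    then have "?E = {}" using top by auto
    then show ?thesis using False by (simp add: wt_def)
  next
    case True
    define low where "low \<pi> k = filter (\<lambda>v. snd v \<le> int n) (\<pi> k)" for \<pi> :: "nat \<Rightarrow> vertex list" and k :: nat
    define run where "run kap k = hrun ?N (kap k - int k) (lam k - int k)" for kap k
    let ?i = "\<lambda>(kap, \<rho>). \<lambda>k\<in>{1..Suc n}. if k = Suc n then [(y (Suc n) - ?N, ?N)] else \<rho> k @ run kap k"
    let ?j = "\<lambda>\<pi>. (\<lambda>k\<in>{1..n}. fst (last (low \<pi> k)) + int k, \<lambda>k\<in>{1..n}. low \<pi> k)"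
    (* The map j cuts the paths below the top level and reads off the row kap, the map i glues the
       runs of the top level back on. *)
    have low_append: "filter (\<lambda>v. snd v \<le> int n) (\<rho> @ run kap k) = \<rho>"
      if "is_path h_step a (c, int n) \<rho>" for \<rho> kap k a c
    proof -
      have "filter (\<lambda>v. snd v \<le> int n) \<rho> = \<rho>"
        using h_step_levels[OF that] by (intro filter_True) auto
      moreover have "filter (\<lambda>v. snd v \<le> int n) (run kap k) = []"
        by (auto simp: run_def set_hrun filter_empty_conv)
      ultimately show ?thesis by simp
    qed
    have decomp: "\<exists>c. c \<le> lam k - int k \<and> up_path n (y k - int k, int k) (c, int n) (low \<pi> k)
        \<and> last (low \<pi> k) = (c, int n) \<and> \<pi> k = low \<pi> k @ hrun ?N c (lam k - int k)"
      if "\<pi> \<in> ?E" and k: "k \<in> {1..n}" for \<pi> k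
    proof -
      have upk: "up_path (Suc n) (y k - int k, int k) (lam k - int k, ?N) (\<pi> k)"
        using that by (simp add: hPi_up_iff pts_def)
      have N: "?N = int n + 1" and kn: "int k \<le> int n" using k by simp_all
      have "is_path h_step (y k - int k, int k) (lam k - int k, int n + 1) (\<pi> k)"
        using upk unfolding up_path_def N by blast
      from is_path_last_level[OF kn this]
      obtain c \<rho> where c: "c \<le> lam k - int k" "is_path h_step (y k - int k, int k) (c, int n) \<rho>"
        "\<pi> k = \<rho> @ hrun ?N c (lam k - int k)"
        unfolding N by blast
      have "low \<pi> k = \<rho>"
        using low_append[OF c(2), of "\<lambda>_. c + int k" k] by (simp add: low_def c(3) run_def)
      moreover have "up_path n (y k - int k, int k) (c, int n) \<rho>"
        using up_path_append[OF c(2,1)] upk c(3) k by simp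
      ultimately show ?thesis using c by (auto simp: is_path_def)
    qed
    have j_in: "?j \<pi> \<in> Sigma (interlacing n lam) ?F" if \<pi>: "\<pi> \<in> ?E" for \<pi>
    proof -
      define kap where "kap = fst (?j \<pi>)"
      have kap: "kap k \<le> lam k" "up_path n (y k - int k, int k) (kap k - int k, int n) (low \<pi> k)"
          "\<pi> k = low \<pi> k @ run kap k" if "k \<in> {1..n}" for k
        using decomp[OF \<pi> that] that by (auto simp: kap_def run_def)
      have dis: "set (\<pi> j) \<inter> set (\<pi> k) = {}" if "j \<in> {1..Suc n}" "k \<in> {1..Suc n}" "j \<noteq> k" for j k
        using \<pi> that unfolding hPi_up_iff by blast
      have "lam (Suc k) \<le> kap k" if k: "k \<in> {1..n}" for k
      proof (rule ccontr)
        assume not: "\<not> lam (Suc k) \<le> kap k"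
        let ?v = "(lam (Suc k) - int (Suc k), ?N)"
        have "lam (Suc k) \<le> lam k" using Weyl_mono[OF lam, of k "Suc k"] k by simp
        then have "?v \<in> set (run kap k)" using not by (auto simp: run_def set_hrun)
        then have "?v \<in> set (\<pi> k)" using kap(3)[OF k] by simp
        moreover have "\<forall>i\<in>{1..Suc n}. is_path h_step (pts y (\<lambda>i. int i) i) (pts lam (\<lambda>_. ?N) i) (\<pi> i)"
          using \<pi> unfolding hPi_up_iff up_path_def by blast
        then have "is_path h_step (pts y (\<lambda>i. int i) (Suc k)) (pts lam (\<lambda>_. ?N) (Suc k)) (\<pi> (Suc k))"
          by (rule bspec) (use k in simp)
        then have "is_path h_step (pts y (\<lambda>i. int i) (Suc k)) ?v (\<pi> (Suc k))"
          unfolding pts_def .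
        then have "?v \<in> set (\<pi> (Suc k))" unfolding is_path_def by (metis last_in_set)
        ultimately show False using dis[of k "Suc k"] k by auto
      qed
      then have "kap \<in> interlacing n lam" using kap(1) by (simp add: interlacing_def PiE_iff kap_def)
      moreover have "(\<lambda>k\<in>{1..n}. low \<pi> k) \<in> ?F kap"
        unfolding hPi_up_iff
      proof (intro conjI ballI impI)
        fix k assume "k \<in> {1..n}"
        then show "up_path n (pts y (\<lambda>i. int i) k) (pts kap (\<lambda>_. int n) k) ((\<lambda>k\<in>{1..n}. low \<pi> k) k)"
          using kap(2)[of k] by (simp add: pts_def)
      next
        fix j k assume "j \<in> {1..n}" "k \<in> {1..n}" "j \<noteq> k"
        then show "set ((\<lambda>k\<in>{1..n}. low \<pi> k) j) \<inter> set ((\<lambda>k\<in>{1..n}. low \<pi> k) k) = {}"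
          using dis[of j k] by (auto simp: low_def)
      qed simp
      ultimately show ?thesis by (simp add: kap_def)
    qed
    have i_in: "?i (kap, \<rho>) \<in> ?E" and ji: "?j (?i (kap, \<rho>)) = (kap, \<rho>)"
      if kap: "kap \<in> interlacing n lam" and \<rho>: "\<rho> \<in> ?F kap" for kap \<rho>
    proof -
      let ?\<pi> = "?i (kap, \<rho>)"
      have bd: "lam (Suc k) \<le> kap k \<and> kap k \<le> lam k" if "k \<in> {1..n}" for k
        using interlacing_bounds[OF kap] that by simp
      have upk: "up_path n (y k - int k, int k) (kap k - int k, int n) (\<rho> k)" if "k \<in> {1..n}" for k
        using \<rho> that by (simp add: hPi_up_iff pts_def)
      have pk: "is_path h_step (y k - int k, int k) (kap k - int k, int n) (\<rho> k)" if "k \<in> {1..n}" for k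
        using upk[OF that] by (simp add: up_path_def)
      have \<pi>k: "?\<pi> k = \<rho> k @ run kap k" if "k \<in> {1..n}" for k using that by simp
      have \<pi>N: "?\<pi> (Suc n) = [(y (Suc n) - ?N, ?N)]" by simp
      have lev: "snd v \<le> int n" if "v \<in> set (\<rho> k)" "k \<in> {1..n}" for v k
        using h_step_levels[OF pk[OF that(2)] that(1)] by simp
      have dis: "set (?\<pi> j) \<inter> set (?\<pi> k) = {}" if jk: "j \<in> {1..Suc n}" "k \<in> {1..Suc n}" "j < k" for j k
      proof -
        have j: "j \<in> {1..n}" using jk by auto
        have lt: "lam k - int k < kap j - int j"
          using bd[OF j] Weyl_mono[OF lam, of "Suc j" k] jk by auto
        show ?thesis
        proof (cases "k = Suc n")
          case True
          then show ?thesis using lt lev[OF _ j] \<open>lam (Suc n) = y (Suc n)\<close>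
            unfolding True \<pi>N \<pi>k[OF j] by (fastforce simp: run_def set_hrun)
        next
          case False
          then have k: "k \<in> {1..n}" using jk by auto
          have "set (\<rho> j) \<inter> set (\<rho> k) = {}" using \<rho> j k less_imp_neq[OF jk(3)] unfolding hPi_up_iff by blast
          moreover have "set (run kap j) \<inter> set (run kap k) = {}"
            using lt by (auto simp: run_def set_hrun)
          moreover have "set (\<rho> i) \<inter> set (run kap l) = {}" if "i \<in> {1..n}" for i l
            using lev[OF _ that] by (fastforce simp: run_def set_hrun)
          ultimately show ?thesis unfolding \<pi>k[OF j] \<pi>k[OF k] using j k by (simp add: Int_Un_distrib Int_Un_distrib2 Int_commute)
        qed
      qed
      show "?\<pi> \<in> ?E"
        unfolding hPi_up_iff
      proof (intro conjI ballI impI)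
        show "?\<pi> \<in> extensional {1..Suc n}" by simp
        fix k assume k: "k \<in> {1..Suc n}"
        show "up_path (Suc n) (pts y (\<lambda>i. int i) k) (pts lam (\<lambda>_. ?N) k) (?\<pi> k)"
        proof (cases "k = Suc n")
          case True
          show ?thesis unfolding True \<pi>N pts_def using up_path_top[of "Suc n"] \<open>lam (Suc n) = y (Suc n)\<close> by simp
        next
          case False
          then have k: "k \<in> {1..n}" using k by auto
          show ?thesis unfolding \<pi>k[OF k] pts_def run_def
            using up_path_append[OF pk[OF k], of "lam k - int k"] upk[OF k] bd[OF k] k by simp
        qed
      next
        fix j k assume jk: "j \<in> {1..Suc n}" "k \<in> {1..Suc n}" "j \<noteq> k"
        then consider "j < k" | "k < j" by linarith
        then show "set (?\<pi> j) \<inter> set (?\<pi> k) = {}"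
        proof cases
          case 1 show ?thesis by (rule dis[OF jk(1,2) 1])
        next
          case 2 show ?thesis using dis[OF jk(2,1) 2] by (simp only: Int_commute)
        qed
      qed
      have l: "low ?\<pi> k = \<rho> k" if "k \<in> {1..n}" for k
        unfolding low_def \<pi>k[OF that] by (rule low_append[OF pk[OF that]])
      have "last (\<rho> k) = (kap k - int k, int n)" if "k \<in> {1..n}" for k
        using pk[OF that] by (simp add: is_path_def)
      with l have "(\<lambda>k\<in>{1..n}. fst (last (low ?\<pi> k)) + int k) = restrict kap {1..n}"
        by (intro restrict_ext) simp
      moreover have "(\<lambda>k\<in>{1..n}. low ?\<pi> k) = restrict \<rho> {1..n}" using l by (intro restrict_ext) simp
      moreover have "restrict kap {1..n} = kap" using kap by (simp add: interlacing_def PiE_restrict)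
      moreover have "restrict \<rho> {1..n} = \<rho>" using \<rho> by (simp add: hPi_up_iff extensional_restrict)
      ultimately show "?j ?\<pi> = (kap, \<rho>)" by simp
    qed
    have wk: "path_weight w (\<rho> @ hrun ?N c b) = path_weight w \<rho> * q (Suc n) powi (b - c)"
      if "\<rho> \<noteq> []" "last \<rho> = (c, int n)" "c \<le> b" "n \<ge> 1" for \<rho> c b
    proof -
      have "hd (hrun ?N c b) = (c, int n + 1)" "hrun ?N c b \<noteq> []"
        using hrun_rec[OF that(3), of ?N] by (simp_all add: add.commute)
      moreover have "w (c, int n) (c, int n + 1) = 1" using Suc.prems(2)[of n c] that(4) by simp
      moreover have "path_weight w (hrun ?N c b) = q (Suc n) powi (b - c)"
        using Suc.prems(3)[of "Suc n"] Suc.prems(4)[of "Suc n"] that(3) by (intro path_weight_hrun) auto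
      ultimately show ?thesis using that by (simp add: path_weight_append)
    qed
    have "wt (Suc n) w ?E = (\<Sum>(kap, \<rho>)\<in>Sigma (interlacing n lam) ?F.
        (\<Prod>k=1..n. q (Suc n) powi (lam k - kap k)) * (\<Prod>k=1..n. path_weight w (\<rho> k)))"
      unfolding wt_def
    proof (rule sum.reindex_bij_witness[of _ ?i ?j])
      fix \<pi> assume \<pi>: "\<pi> \<in> ?E"
      show "?i (?j \<pi>) = \<pi>"
      proof (rule extensionalityI[where A = "{1..Suc n}"])
        show "\<pi> \<in> extensional {1..Suc n}" using \<pi> by (simp add: hPi_up_iff)
        fix k assume k: "k \<in> {1..Suc n}"
        show "?i (?j \<pi>) k = \<pi> k"
        proof (cases "k = Suc n")
          case True
          then show ?thesis using top[OF \<pi>] by simp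
        next
          case False
          then have k: "k \<in> {1..n}" using k by auto
          obtain c where "last (low \<pi> k) = (c, int n)" "\<pi> k = low \<pi> k @ hrun ?N c (lam k - int k)"
            using decomp[OF \<pi> k] by blast
          then show ?thesis using k by (simp add: run_def)
        qed
      qed simp
      show "?j \<pi> \<in> Sigma (interlacing n lam) ?F" by (rule j_in[OF \<pi>])
      show "(case ?j \<pi> of (kap, \<rho>) \<Rightarrow> (\<Prod>k=1..n. q (Suc n) powi (lam k - kap k)) * (\<Prod>k=1..n. path_weight w (\<rho> k)))
        = (\<Prod>k=1..Suc n. path_weight w (\<pi> k))"
        unfolding prod.case prod.distrib[symmetric] prod_1_Suc conjunct1[OF top[OF \<pi>]] path_weight_simps mult_1_right
      proof (rule prod.cong[OF refl])
        fix k assume k: "k \<in> {1..n}"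
        obtain c where c: "c \<le> lam k - int k" "up_path n (y k - int k, int k) (c, int n) (low \<pi> k)"
            "last (low \<pi> k) = (c, int n)" "\<pi> k = low \<pi> k @ hrun ?N c (lam k - int k)"
          using decomp[OF \<pi> k] by blast
        have "low \<pi> k \<noteq> []" using c(2) by (auto simp: up_path_def)
        then have "path_weight w (\<pi> k) = path_weight w (low \<pi> k) * q (Suc n) powi (lam k - int k - c)"
          using wk[OF _ c(3,1)] k c(4) by simp
        then show "q (Suc n) powi (lam k - (\<lambda>k\<in>{1..n}. fst (last (low \<pi> k)) + int k) k) *
            path_weight w ((\<lambda>k\<in>{1..n}. low \<pi> k) k) = path_weight w (\<pi> k)"
          using k c(3) by (simp add: algebra_simps)
      qed
    next
      fix b assume "b \<in> Sigma (interlacing n lam) ?F"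
      then obtain kap \<rho> where b: "b = (kap, \<rho>)" "kap \<in> interlacing n lam" "\<rho> \<in> ?F kap" by blast
      show "?i b \<in> ?E" unfolding b(1) by (rule i_in[OF b(2,3)])
      show "?j (?i b) = b" unfolding b(1) by (rule ji[OF b(2,3)])
    qed
    also have "\<dots> = (\<Sum>kap\<in>interlacing n lam. (\<Prod>k=1..n. q (Suc n) powi (lam k - kap k)) * wt n w (?F kap))"
      unfolding wt_def sum_distrib_left
    proof (rule sum.Sigma[symmetric])
      have sub: "?F kap \<subseteq> hPi n (pts y (\<lambda>i. int i)) (pts kap (\<lambda>_. int n))" for kap
        unfolding hPi_up_def by (rule Collect_subset)
      show "\<forall>kap\<in>interlacing n lam. finite (?F kap)"
        by (intro ballI finite_subset[OF sub finite_path_ensemble[OF graded_h_step]])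
    qed simp
    also have "\<dots> = gt_weight q (Suc n) lam y"
      using True Suc.IH[OF interlacing_Weyl] Suc.prems(2-4) by simp
    finally show ?thesis .
  qed
qed

section \<open>The transition probability as a weight of path ensembles\<close>

lemma hPi_up_subset: "hPi_up n A B \<subseteq> hPi n A B"
  unfolding hPi_up_def by (rule Collect_subset)

text \<open>
  Each path has to stay on its level, so the ensemble has a single element.
\<close>

lemma wt_horizontal:
  assumes le: "\<And>k. k \<in> {1..n} \<Longrightarrow> x k \<le> y k"
    and hor: "\<And>a j. 1 \<le> j \<Longrightarrow> j \<le> n \<Longrightarrow> w (a, int j) (a + 1, int j) = q j"
    and q: "\<And>j. 1 \<le> j \<Longrightarrow> j \<le> n \<Longrightarrow> q j > 0"
  shows "wt n w (hPi n (pts x (\<lambda>i. int i)) (pts y (\<lambda>i. int i))) = (\<Prod>k=1..n. q k powi (y k - x k))"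
proof -
  let ?p = "\<lambda>k\<in>{1..n}. hrun (int k) (x k - int k) (y k - int k)"
  have path: "is_path h_step (pts x (\<lambda>i. int i) k) (pts y (\<lambda>i. int i) k) \<pi> \<longleftrightarrow> \<pi> = ?p k"
    if "k \<in> {1..n}" for k \<pi>
    using is_path_horizontal[of "x k - int k" "int k" "y k - int k" \<pi>] le[OF that] that by (simp add: pts_def)
  have "\<pi> = ?p" if "\<pi> \<in> hPi n (pts x (\<lambda>i. int i)) (pts y (\<lambda>i. int i))" for \<pi>
  proof (rule extensionalityI[where A = "{1..n}"])
    show "\<pi> \<in> extensional {1..n}" using that unfolding path_ensemble_iff by blast
    fix k assume k: "k \<in> {1..n}"
    then have "is_path h_step (pts x (\<lambda>i. int i) k) (pts y (\<lambda>i. int i) k) (\<pi> k)"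
      using that unfolding path_ensemble_iff by blast
    then show "\<pi> k = ?p k" using path[OF k] by blast
  qed simp
  moreover have "?p \<in> hPi n (pts x (\<lambda>i. int i)) (pts y (\<lambda>i. int i))"
    unfolding path_ensemble_iff
  proof (intro conjI ballI impI)
    fix k assume k: "k \<in> {1..n}"
    show "is_path h_step (pts x (\<lambda>i. int i) k) (pts y (\<lambda>i. int i) k) (?p k)" using path[OF k] by blast
  qed (auto simp: set_hrun)
  ultimately have "hPi n (pts x (\<lambda>i. int i)) (pts y (\<lambda>i. int i)) = {?p}" by blast
  then have "wt n w (hPi n (pts x (\<lambda>i. int i)) (pts y (\<lambda>i. int i))) = (\<Prod>k=1..n. path_weight w (?p k))"
    by (simp add: wt_def)
  also have "\<dots> = (\<Prod>k=1..n. q k powi (y k - x k))"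
  proof (rule prod.cong[OF refl])
    fix k assume k: "k \<in> {1..n}"
    have "path_weight w (hrun (int k) (x k - int k) (y k - int k)) = q k powi (y k - int k - (x k - int k))"
      using hor[of k] q[of k] le[OF k] k by (intro path_weight_hrun) auto
    then show "path_weight w (?p k) = q k powi (y k - x k)" using k by simp
  qed
  finally show ?thesis .
qed

text \<open>
  The infinite sum has only finitely many nonzero terms, by the supports of the three weights, and
  iterating it gives the composition of the operators.
\<close>

lemma infsum_intermediates:
  "(\<Sum>\<^sub>\<infinity>(lam, mu)\<in>intermediates N y y'. gt_weight q N lam y' * strips_weight p r N m lam mu * inverse_weight q N y mu)
    = inverse_op q N y (strips_op p r N m (\<lambda>lam. gt_weight q N lam y'))"
proof -
  let ?S = "(SIGMA mu:drops N y. lifts N m mu)"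
  let ?f = "\<lambda>lam mu. gt_weight q N lam y' * strips_weight p r N m lam mu * inverse_weight q N y mu"
  have "(\<Sum>\<^sub>\<infinity>(lam, mu)\<in>intermediates N y y'. ?f lam mu) = (\<Sum>\<^sub>\<infinity>(lam, mu)\<in>prod.swap ` ?S. ?f lam mu)"
  proof (rule infsum_cong_neutral)
    fix x assume x: "x \<in> prod.swap ` ?S - intermediates N y y'"
    obtain lam mu where xe: "x = (lam, mu)" by (cases x)
    have W: "lam \<in> Weyl N" "mu \<in> Weyl N" and "contained N mu lam" "contained N mu y"
      using x by (auto simp: xe lifts_def drops_def contained_def PiE_iff)
    then have "\<not> contained N y' lam" using x by (auto simp: xe intermediates_def)
    then have "gt_weight q N lam y' = 0"
      unfolding contained_def by (meson atLeastAtMost_iff gt_weight_support)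
    then show "(case x of (lam, mu) \<Rightarrow> ?f lam mu) = 0" by (simp add: xe)
  next
    fix x assume x: "x \<in> intermediates N y y' - prod.swap ` ?S"
    obtain lam mu where xe: "x = (lam, mu)" by (cases x)
    have "lam \<in> Weyl N" "mu \<in> Weyl N" "\<not> (mu \<in> drops N y \<and> lam \<in> lifts N m mu)"
      using x by (auto simp: xe intermediates_def image_iff)
    then show "(case x of (lam, mu) \<Rightarrow> ?f lam mu) = 0"
      using strips_weight_lifts[of p r N m lam mu] inverse_weight_drops[of q N y mu] by (auto simp: xe)
  qed simp
  also have "\<dots> = (\<Sum>(lam, mu)\<in>prod.swap ` ?S. ?f lam mu)"
    by (intro infsum_finite finite_imageI finite_SigmaI) auto
  also have "\<dots> = (\<Sum>(mu, lam)\<in>?S. ?f lam mu)"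
    by (subst sum.reindex) (auto simp: case_prod_unfold)
  also have "\<dots> = (\<Sum>mu\<in>drops N y. \<Sum>lam\<in>lifts N m mu. ?f lam mu)"
    by (rule sum.Sigma[symmetric]) auto
  also have "\<dots> = (\<Sum>mu\<in>drops N y. inverse_weight q N y mu * strips_op p r N m (\<lambda>lam. gt_weight q N lam y') mu)"
  proof (rule sum.cong[OF refl])
    fix mu assume "mu \<in> drops N y"
    then have "mu \<in> Weyl N" by (simp add: drops_def)
    from strips_op_eq_sum[OF this]
    show "(\<Sum>lam\<in>lifts N m mu. ?f lam mu) = inverse_weight q N y mu * strips_op p r N m (\<lambda>lam. gt_weight q N lam y') mu"
      by (simp add: sum_distrib_left mult_ac)
  qed
  finally show ?thesis unfolding inverse_op_eq_sum .
qed

lemma wt_three_pieces: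
  assumes "lam \<in> Weyl N" "mu \<in> Weyl N" and q: "\<forall>i\<in>{1..N}. q i > 0" and rt: "r \<le> t"
  shows "wt N (edge_weight N p q r t) (hPi_up N (pts y' (\<lambda>i. int i)) (pts lam (\<lambda>i. int N))) = gt_weight q N lam y'"
    and "wt N (edge_weight N p q r t) (ePi_star N (pts lam (\<lambda>i. int N)) (pts mu (\<lambda>i. int N + int t - int r)))
      = strips_weight p r N (t - r) lam mu"
    and "wt N (edge_weight N p q r t) (ePi N (pts mu (\<lambda>i. int N + int t - int r))
                    (pts y (\<lambda>i. 2 * int N + int t - int r - int i))) = inverse_weight q N y mu"
proof -
  show "wt N (edge_weight N p q r t) (hPi_up N (pts y' (\<lambda>i. int i)) (pts lam (\<lambda>i. int N))) = gt_weight q N lam y'"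
    by (rule wt_up[OF assms(1)]) (use q in auto)
  have lev: "int N + int t - int r = int N + int (t - r)" using rt by simp
  show "wt N (edge_weight N p q r t) (ePi_star N (pts lam (\<lambda>i. int N)) (pts mu (\<lambda>i. int N + int t - int r)))
      = strips_weight p r N (t - r) lam mu"
    unfolding lev
  proof (rule wt_strips[OF assms(1,2)])
    fix x j assume j: "j < t - r"
    show "edge_weight N p q r t (x, int N + int j) (x, int N + int j + 1) = 1" by simp
    have "nat (int N + int t - (int N + int j)) = r + (t - r) - j" using j by simp
    then show "edge_weight N p q r t (x, int N + int j) (x - 1, int N + int j + 1) = p (r + (t - r) - j)"
      using j by simp
  qed
  have lev2: "(\<lambda>i. 2 * int N + int t - int r - int i) = (\<lambda>i. (int N + int t - int r) + int N - int i)" by auto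
  show "wt N (edge_weight N p q r t) (ePi N (pts mu (\<lambda>i. int N + int t - int r))
                    (pts y (\<lambda>i. 2 * int N + int t - int r - int i))) = inverse_weight q N y mu"
    unfolding lev2
  proof (rule wt_inverse[OF assms(2)])
    fix x j assume j: "j + 1 < N"
    show "edge_weight N p q r t (x, int N + int t - int r + int j) (x, int N + int t - int r + int j + 1) = 1"
      by simp
    have "nat (2 * int N + int t - int r - (int N + int t - int r + int j)) = N - j" using j by simp
    then show "edge_weight N p q r t (x, int N + int t - int r + int j) (x + 1, int N + int t - int r + int j + 1)
      = - q (N - j)" using j rt by simp
  qed
qed

theorem proposition3p5:
  fixes N r t :: nat and p q :: "nat \<Rightarrow> real" and y y' :: "nat \<Rightarrow> int"
  assumes "N \<ge> 2"
    and "\<forall>i\<ge>1. p i > 0"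
    and "\<forall>i\<in>{1..N}. q i > 1"
    and "r < t"
    and "y \<in> Weyl N" and "y' \<in> Weyl N"
    and "contained N y y'"
  shows "dtasep_prob N p q r t y y' =
      (\<Prod>i = 1..N. q i powi (y' i - y i)) / Zconst N p q r t *
      (\<Sum>\<^sub>\<infinity>(lam, mu)\<in>intermediates N y y'.
         wt N (edge_weight N p q r t)
           (hPi_up N (pts y' (\<lambda>i. int i)) (pts lam (\<lambda>i. int N))
            \<squnion>\<^bsub>N\<^esub> ePi_star N (pts lam (\<lambda>i. int N)) (pts mu (\<lambda>i. int N + int t - int r))
            \<squnion>\<^bsub>N\<^esub> ePi N (pts mu (\<lambda>i. int N + int t - int r))
                    (pts y (\<lambda>i. 2 * int N + int t - int r - int i))))
    \<and> (\<forall>x0::int. x0 - 1 < y N - int N \<longrightarrow>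
        dtasep_prob N p q r t y y' =
        1 / (Zconst N p q r t * (\<Prod>i = 1..N. q i powi (y i - x0))) *
        (\<Sum>\<^sub>\<infinity>(lam, mu)\<in>intermediates N y y'.
           wt N (edge_weight N p q r t)
             (hPi N (pts (\<lambda>i. x0) (\<lambda>i. int i)) (pts y' (\<lambda>i. int i))
              \<squnion>\<^bsub>N\<^esub> hPi_up N (pts y' (\<lambda>i. int i)) (pts lam (\<lambda>i. int N))
              \<squnion>\<^bsub>N\<^esub> ePi_star N (pts lam (\<lambda>i. int N)) (pts mu (\<lambda>i. int N + int t - int r))
              \<squnion>\<^bsub>N\<^esub> ePi N (pts mu (\<lambda>i. int N + int t - int r))
                      (pts y (\<lambda>i. 2 * int N + int t - int r - int i)))))"
proof -
  have q: "q i > 0" if "1 \<le> i" "i \<le> N" for i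
    using assms(3) that by (meson atLeastAtMost_iff less_trans zero_less_one)
  then have q0: "\<forall>i\<in>{1..N}. q i > 0" by simp
  have p: "p i > 0" if "i \<ge> 1" for i using assms(2) that by blast
  have rt: "r \<le> t" using assms(4) by simp
  let ?w = "edge_weight N p q r t"
  let ?R = "\<lambda>x0. hPi N (pts (\<lambda>i. x0) (\<lambda>i. int i)) (pts y' (\<lambda>i. int i))"
  let ?H = "\<lambda>lam. hPi_up N (pts y' (\<lambda>i. int i)) (pts lam (\<lambda>i. int N))"
  let ?S = "\<lambda>lam mu. ePi_star N (pts lam (\<lambda>i. int N)) (pts mu (\<lambda>i. int N + int t - int r))"
  let ?E = "\<lambda>mu. ePi N (pts mu (\<lambda>i. int N + int t - int r)) (pts y (\<lambda>i. 2 * int N + int t - int r - int i))"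
  let ?I = "intermediates N y y'"
  let ?f = "\<lambda>lam mu. gt_weight q N lam y' * strips_weight p r N (t - r) lam mu * inverse_weight q N y mu"
  let ?B = "inverse_op q N y (strips_op p r N (t - r) (\<lambda>lam. gt_weight q N lam y'))"
  note fH0 = framed_path_ensemble[OF graded_h_step order_refl]
  note fH = framed_path_ensemble[OF graded_h_step hPi_up_subset]
  note fS = framed_path_ensemble[OF graded_lstep[of "-1", folded estar_step_eq] order_refl]
  note fE = framed_path_ensemble[OF graded_lstep[of 1, folded e_step_eq] order_refl]
  have W: "lam \<in> Weyl N" "mu \<in> Weyl N" if "(lam, mu) \<in> ?I" for lam mu
    using that by (auto simp: intermediates_def)
  have prob: "dtasep_prob N p q r t y y' = (\<Prod>i=1..N. q i powi (y' i - y i)) / Zconst N p q r t * ?B"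
    using dtasep_prob_eq_operators[where p = p and q = q and N = N and r = r and m = "t - r" and y' = y',
        OF assms(5) p q] rt by simp
  have three: "wt N ?w (?H lam \<squnion>\<^bsub>N\<^esub> ?S lam mu \<squnion>\<^bsub>N\<^esub> ?E mu) = ?f lam mu" if "(lam, mu) \<in> ?I" for lam mu
    unfolding wt_concat[OF framed_concat[OF fH fS] fE] wt_concat[OF fH fS]
      wt_three_pieces[OF W[OF that] q0 rt] ..
  have sum3: "(\<Sum>\<^sub>\<infinity>(lam, mu)\<in>?I. wt N ?w (?H lam \<squnion>\<^bsub>N\<^esub> ?S lam mu \<squnion>\<^bsub>N\<^esub> ?E mu)) = ?B"
    unfolding infsum_intermediates[symmetric] by (rule infsum_cong) (use three in auto)
  have second: "dtasep_prob N p q r t y y' = 1 / (Zconst N p q r t * (\<Prod>i = 1..N. q i powi (y i - x0))) *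
      (\<Sum>\<^sub>\<infinity>(lam, mu)\<in>?I. wt N ?w (?R x0 \<squnion>\<^bsub>N\<^esub> ?H lam \<squnion>\<^bsub>N\<^esub> ?S lam mu \<squnion>\<^bsub>N\<^esub> ?E mu))"
    if x0: "x0 - 1 < y N - int N" for x0
  proof -
    let ?c = "\<Prod>i=1..N. q i powi (y' i - x0)" and ?d = "\<Prod>i = 1..N. q i powi (y i - x0)"
    have le: "x0 \<le> y' k" if "k \<in> {1..N}" for k
    proof -
      have "y N \<le> y k" "y k \<le> y' k"
        using Weyl_mono[OF assms(5), of k N] assms(7) that by (auto simp: contained_def)
      then show ?thesis using x0 assms(1) by linarith
    qed
    have w0: "wt N ?w (?R x0) = ?c"
      by (rule wt_horizontal[OF le]) (use q in auto)
    have four: "wt N ?w (?R x0 \<squnion>\<^bsub>N\<^esub> ?H lam \<squnion>\<^bsub>N\<^esub> ?S lam mu \<squnion>\<^bsub>N\<^esub> ?E mu) = ?c * ?f lam mu"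
      if "(lam, mu) \<in> ?I" for lam mu
      unfolding wt_concat[OF framed_concat[OF framed_concat[OF fH0 fH] fS] fE]
        wt_concat[OF framed_concat[OF fH0 fH] fS] wt_concat[OF fH0 fH]
        wt_three_pieces[OF W[OF that] q0 rt] w0 by (simp only: mult.assoc)
    have "(\<Sum>\<^sub>\<infinity>(lam, mu)\<in>?I. wt N ?w (?R x0 \<squnion>\<^bsub>N\<^esub> ?H lam \<squnion>\<^bsub>N\<^esub> ?S lam mu \<squnion>\<^bsub>N\<^esub> ?E mu))
        = (\<Sum>\<^sub>\<infinity>x\<in>?I. ?c * (case x of (lam, mu) \<Rightarrow> ?f lam mu))"
      by (rule infsum_cong) (use four in auto)
    also have "\<dots> = ?c * ?B"
      unfolding infsum_cmult_right' infsum_intermediates ..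
    finally have sum4: "(\<Sum>\<^sub>\<infinity>(lam, mu)\<in>?I. wt N ?w (?R x0 \<squnion>\<^bsub>N\<^esub> ?H lam \<squnion>\<^bsub>N\<^esub> ?S lam mu \<squnion>\<^bsub>N\<^esub> ?E mu)) = ?c * ?B" .
    have c: "?c = (\<Prod>i=1..N. q i powi (y' i - y i)) * ?d"
      unfolding prod.distrib[symmetric]
    proof (rule prod.cong[OF refl])
      fix i assume "i \<in> {1..N}"
      then have "q i \<noteq> 0" using q[of i] by auto
      then show "q i powi (y' i - x0) = q i powi (y' i - y i) * q i powi (y i - x0)"
        by (simp flip: power_int_add)
    qed
    have "q i powi (y i - x0) \<noteq> 0" if "i \<in> {1..N}" for i
      using q[of i] that by auto
    then have d: "?d \<noteq> 0" unfolding prod_zero_iff[OF finite_atLeastAtMost] by blast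
    have cancel: "a / z * b = 1 / (z * d) * (a * d * b)" if "d \<noteq> 0" for a b d z :: real
      using that by simp
    show ?thesis unfolding sum4 prob c by (rule cancel[OF d])
  qed
  show ?thesis
    using prob second unfolding sum3 by blast
qed

end
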